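(* Let $u,v,w\in\mathbb C$ with $v+w\ne0$. The limit distribution $(\lambda,\mu,\nu)=(\lambda^{(u,v,w)},\mu^{(v,w)},\nu^{(v,w)})$ of the $\alpha$-free central limit theorem is characterized by the reciprocal Cauchy transforms $$F_\lambda(z)=\Big(1-\frac{u}{v+w}\Big)z+\frac{uz}{v+w}\sqrt{1-\frac{2(v+w)}{z^2}},$$ $$F_\mu(z)=\Big(1-\frac{v}{v+w}\Big)z+\frac{vz}{v+w}\sqrt{1-\frac{2(v+w)}{z^2}},$$ $$F_\nu(z)=\Big(1-\frac{w}{v+w}\Big)z+\frac{wz}{v+w}\sqrt{1-\frac{2(v+w)}{z^2}},$$ where $\sqrt{1+y}$ is interpreted as the formal power series $\sum_{k\ge0}\binom{1/2}{k}y^k$ in $y$.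
   Context: A distribution is a unital linear functional on $\mathbb C[x]$. For a distribution $\mu$, $G_\mu(z)=\sum_{n\ge0}\mu(x^n)z^{-n-1}$ and $F_\mu(z)=1/G_\mu(z)$, as formal Laurent series in $z^{-1}$. The distributions $\lambda^{(u,v,w)},\mu^{(v,w)},\nu^{(v,w)}$ (the limits, in moments, of the normalized sums $(a_1+\cdots+a_n)/\sqrt n$ of identically distributed $\alpha$-free centered elements with variances $u,v,w$ with respect to the three functionals) are given by $$\lambda^{(u,v,w)}(x^{2p-1})=0,\qquad \lambda^{(u,v,w)}(x^{2p})=\sum_{\pi\in\mathcal{ONC}_{\rm pair}(2p)}\frac1{p!}\,u^{\#\mathscr O(\pi)}v^{\#\mathscr B(\pi)}w^{\#\mathscr C(\pi)}\qquad(p\ge1),$$ $\mu^{(v,w)}=\lambda^{(v,v,w)}$ and $\nu^{(v,w)}=\lambda^{(w,v,w)}$, with the following notation. An ordered set partition of $[n]$ is a sequence $\pi=(P_1,\dots,P_p)$ whose entries form a set partition of $[n]$; $P_i$ precedes $P_j$ if $i<j$. $\mathcal{ONC}_{\rm pair}(n)$ is the set of those whose underlying set partition is noncrossing and whose blocks all have cardinality two. A block $P'$ covers $P$ if there are $i,j\in P'$ with $i<k<j$ for all $k\in P$. Blocks covered by another block are inner, the others outer; $\mathscr O(\pi)$ is the set of outer blocks. The nearest cover $C(P)$ of an inner block $P$ is the unique block covering $P$ such that no block $P'$ covers $P$ and is covered by $C(P)$. $\mathscr B(\pi)$ = set of inner blocks $P$ such that $C(P)$ precedes $P$; $\mathscr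 C(\pi)$ = set of inner blocks $P$ that precede $C(P)$. *)

theory Defs
  imports
    "HOL-Computational_Algebra.Computational_Algebra"
    "HOL-Library.Disjoint_Sets"
begin

definition distribution :: "(complex poly \<Rightarrow> complex) \<Rightarrow> bool" where
  "distribution \<phi> \<longleftrightarrow> Vector_Spaces.linear smult (*) \<phi> \<and> \<phi> 1 = 1"

text \<open>
  Formal Laurent series in \<open>z\<^sup>-\<^sup>1\<close>: the library indeterminate \<open>fls_X\<close> (and \<open>fps_X\<close>)
  stands for \<open>z\<^sup>-\<^sup>1\<close>, so that \<open>z\<close> itself is \<open>fls_X_inv\<close>. The polynomial \<open>x\<^sup>n\<close> is \<open>monom 1 n\<close>.
\<close>

abbreviation zvar :: "complex fls" where
  "zvar \<equiv> fls_X_inv"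

definition cauchy_transform :: "(complex poly \<Rightarrow> complex) \<Rightarrow> complex fls" where
  "cauchy_transform \<phi> = fps_to_fls (fps_X * Abs_fps (\<lambda>n. \<phi> (monom 1 n)))"

definition reciprocal_cauchy_transform :: "(complex poly \<Rightarrow> complex) \<Rightarrow> complex fls" where
  "reciprocal_cauchy_transform \<phi> = 1 / cauchy_transform \<phi>"

text \<open>
  \<open>sqrt_one_minus_over_z2 c\<close> is the series of \<open>sqrt (1 - c / z\<^sup>2)\<close>, obtained by substituting
  \<open>y = - c / z\<^sup>2\<close> into the formal power series \<open>\<Sum>k. ((1/2) gchoose k) * y ^ k\<close>.
\<close>

definition sqrt_one_minus_over_z2 :: "complex \<Rightarrow> complex fls" where
  "sqrt_one_minus_over_z2 c = fps_to_fls (fps_binomial (1/2) oo (fps_const (- c) * fps_X ^ 2))"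

definition noncrossing :: "nat set set \<Rightarrow> bool" where
  "noncrossing P \<longleftrightarrow>
     \<not> (\<exists>A\<in>P. \<exists>B\<in>P. A \<noteq> B \<and>
          (\<exists>i\<in>A. \<exists>j\<in>B. \<exists>k\<in>A. \<exists>l\<in>B. i < j \<and> j < k \<and> k < l))"

definition ordered_set_partition :: "nat \<Rightarrow> nat set list \<Rightarrow> bool" where
  "ordered_set_partition n \<pi> \<longleftrightarrow> distinct \<pi> \<and> partition_on {1..n} (set \<pi>)"

definition ONC_pair :: "nat \<Rightarrow> nat set list set" where
  "ONC_pair n =
     {\<pi>. ordered_set_partition n \<pi> \<and> noncrossing (set \<pi>) \<and> (\<forall>P\<in>set \<pi>. card P = 2)}"

definition precedes :: "nat set list \<Rightarrow> nat set \<Rightarrow> nat set \<Rightarrow> bool" where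
  "precedes \<pi> P Q \<longleftrightarrow> (\<exists>i j. i < j \<and> j < length \<pi> \<and> \<pi> ! i = P \<and> \<pi> ! j = Q)"

definition covers :: "nat set \<Rightarrow> nat set \<Rightarrow> bool" where
  "covers P' P \<longleftrightarrow> (\<exists>i\<in>P'. \<exists>j\<in>P'. \<forall>k\<in>P. i < k \<and> k < j)"

definition inner_blocks :: "nat set list \<Rightarrow> nat set set" where
  "inner_blocks \<pi> = {P \<in> set \<pi>. \<exists>P'\<in>set \<pi>. covers P' P}"

definition outer_blocks :: "nat set list \<Rightarrow> nat set set" where
  "outer_blocks \<pi> = set \<pi> - inner_blocks \<pi>"

definition nearest_cover :: "nat set list \<Rightarrow> nat set \<Rightarrow> nat set" where
  "nearest_cover \<pi> P =
     (THE C. C \<in> set \<pi> \<and> covers C P \<and> \<not> (\<exists>P'\<in>set \<pi>. covers P' P \<and> covers C P'))"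

definition blocks_B :: "nat set list \<Rightarrow> nat set set" where
  "blocks_B \<pi> = {P \<in> inner_blocks \<pi>. precedes \<pi> (nearest_cover \<pi> P) P}"

definition blocks_C :: "nat set list \<Rightarrow> nat set set" where
  "blocks_C \<pi> = {P \<in> inner_blocks \<pi>. precedes \<pi> P (nearest_cover \<pi> P)}"

definition lambda_moment :: "complex \<Rightarrow> complex \<Rightarrow> complex \<Rightarrow> nat \<Rightarrow> complex" where
  "lambda_moment u v w n =
     (if n = 0 then 1
      else if odd n then 0
      else (\<Sum>\<pi>\<in>ONC_pair n.
              1 / fact (n div 2) * u ^ card (outer_blocks \<pi>) *
              v ^ card (blocks_B \<pi>) * w ^ card (blocks_C \<pi>)))"

text \<open>Linear extension of the moments to all polynomials.\<close>

definition lambda_dist :: "complex \<Rightarrow> complex \<Rightarrow> complex \<Rightarrow> complex poly \<Rightarrow> complex" where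
  "lambda_dist u v w p = (\<Sum>n\<le>degree p. coeff p n * lambda_moment u v w n)"

definition mu_dist :: "complex \<Rightarrow> complex \<Rightarrow> complex poly \<Rightarrow> complex" where
  "mu_dist v w = lambda_dist v v w"

definition nu_dist :: "complex \<Rightarrow> complex \<Rightarrow> complex poly \<Rightarrow> complex" where
  "nu_dist v w = lambda_dist w v w"

end

theory Submission
  imports Defs "HOL-Library.Tree"
begin

text \<open>
  An ordered noncrossing pair partition is a binary tree with distinct labels: the label of a block
  is its position in the order, the left subtree describes what the leftmost block covers and the
  right subtree what follows it. With \<open>N\<close>, \<open>T\<close> and \<open>F\<close> the weighted sums over all forests with outer
  weight \<open>w\<close>, all trees with root weight 1, and all forests with outer weight \<open>u\<close>, the
  decomposition at the leftmost block gives \<open>F = 1 + u T F\<close> for exponential generating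
  functions. Removing the block with the largest label, which carries the weight \<open>v\<close> unless it is
  outer and gives all its children the weight \<open>w\<close>, leaves its inside (counted by \<open>N\<close>) and
  a tree with \<open>k\<close> blocks and one of \<open>2 k - 1\<close> marked gaps inside the root, so
  \<open>T' = N (1 + v (2 t T' - T))\<close>. Together with \<open>N = 1 + w T N\<close> this forces
  \<open>T = (1 - sqrt (1 - 2 (v + w) t)) / (v + w)\<close>, and the moments are the coefficients of
  \<open>1 / (1 - u T)\<close>.
\<close>

section \<open>Convolution of functions on finite sets\<close>

text \<open>The counterpart, on set functions, of the product of exponential generating functions:
  the labels are distributed between two structures. Cardinalities alone would not do, since root
  weights such as \<open>edge_weight v w x\<close> depend on the labels themselves.\<close>

definition subset_conv ::
    "('a set \<Rightarrow> 'b::comm_semiring_1) \<Rightarrow> ('a set \<Rightarrow> 'b) \<Rightarrow> 'a set \<Rightarrow> 'b" where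
  "subset_conv f g S = (\<Sum>A\<in>Pow S. f A * g (S - A))"

lemma subset_conv_cong:
  assumes "\<And>A. A \<subseteq> S \<Longrightarrow> f A * g (S - A) = f' A * g' (S - A)"
  shows "subset_conv f g S = subset_conv f' g' S"
  unfolding subset_conv_def by (rule sum.cong) (use assms in auto)

lemma subset_conv_empty [simp]: "subset_conv f g {} = f {} * g {}"
  by (simp add: subset_conv_def)

lemma subset_conv_add_right:
  "subset_conv f (\<lambda>A. g A + h A) S = subset_conv f g S + subset_conv f h S"
  by (simp add: subset_conv_def distrib_left sum.distrib)

lemma subset_conv_add_left:
  "subset_conv (\<lambda>A. f A + g A) h S = subset_conv f h S + subset_conv g h S"
  by (simp add: subset_conv_def distrib_right sum.distrib)

lemma subset_conv_scale_left: "subset_conv (\<lambda>A. c * f A) g S = c * subset_conv f g S"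
  by (simp add: subset_conv_def sum_distrib_left mult_ac)

lemma subset_conv_scale_right: "subset_conv f (\<lambda>A. c * g A) S = c * subset_conv f g S"
  by (simp add: subset_conv_def sum_distrib_left mult_ac)

lemma subset_conv_unit_left:
  assumes "finite S"
  shows "subset_conv (\<lambda>A. of_bool (A = {})) g S = g S"
proof -
  have "subset_conv (\<lambda>A. of_bool (A = {})) g S = (\<Sum>A\<in>Pow S. if A = {} then g (S - A) else 0)"
    unfolding subset_conv_def by (rule sum.cong) auto
  also have "\<dots> = g S"
    using assms by (subst sum.delta) auto
  finally show ?thesis .
qed

lemma subset_conv_commute: "subset_conv f g S = subset_conv g f S"
  unfolding subset_conv_def
  by (rule sum.reindex_bij_witness[of _ "\<lambda>A. S - A" "\<lambda>A. S - A"])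
     (auto simp: mult.commute double_diff)

lemma subset_conv_assoc:
  assumes "finite S"
  shows "subset_conv (subset_conv f g) h S = subset_conv f (subset_conv g h) S"
proof -
  have fin: "finite A" if "A \<subseteq> S" for A
    using assms that by (rule finite_subset[rotated])
  have "subset_conv (subset_conv f g) h S =
      (\<Sum>A\<in>Pow S. \<Sum>B\<in>Pow A. f B * g (A - B) * h (S - A))"
    by (simp add: subset_conv_def sum_distrib_right)
  also have "\<dots> = (\<Sum>(A, B)\<in>(SIGMA A:Pow S. Pow A). f B * g (A - B) * h (S - A))"
    by (subst sum.Sigma) (use assms fin in auto)
  also have "\<dots> = (\<Sum>(B, C)\<in>(SIGMA B:Pow S. Pow (S - B)). f B * (g C * h (S - B - C)))"
  proof (rule sum.reindex_bij_witness[of _ "\<lambda>(B, C). (B \<union> C, B)" "\<lambda>(A, B). (B, A - B)"])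
    fix p assume "p \<in> (SIGMA A:Pow S. Pow A)"
    moreover obtain A B where "p = (A, B)" by force
    moreover have "S - B - (A - B) = S - A" if "B \<subseteq> A" using that by auto
    ultimately show "(case case p of (A, B) \<Rightarrow> (B, A - B) of
        (B, C) \<Rightarrow> f B * (g C * h (S - B - C))) = (case p of (A, B) \<Rightarrow> f B * g (A - B) * h (S - A))"
      by (auto simp: mult.assoc)
  qed auto
  also have "\<dots> = (\<Sum>B\<in>Pow S. \<Sum>C\<in>Pow (S - B). f B * (g C * h (S - B - C)))"
    by (subst sum.Sigma) (use assms fin in auto)
  also have "\<dots> = subset_conv f (subset_conv g h) S"
    by (simp add: subset_conv_def sum_distrib_left)
  finally show ?thesis .
qed

text \<open>Leibniz rule: adjoining a fresh label acts like the derivative of an exponential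
  generating function, and the fresh label falls to one of the two factors.\<close>

lemma subset_conv_insert:
  assumes "finite S" "x \<notin> S"
  shows "subset_conv f g (insert x S) =
    subset_conv (\<lambda>A. f (insert x A)) g S + subset_conv f (\<lambda>A. g (insert x A)) S"
proof -
  have "subset_conv f g (insert x S) =
      (\<Sum>A\<in>Pow S. f A * g (insert x S - A)) + (\<Sum>A\<in>insert x ` Pow S. f A * g (insert x S - A))"
    unfolding subset_conv_def Pow_insert
    by (rule sum.union_disjoint) (use assms in auto)
  also have "(\<Sum>A\<in>Pow S. f A * g (insert x S - A)) = subset_conv f (\<lambda>A. g (insert x A)) S"
    unfolding subset_conv_def
    by (rule sum.cong) (use assms in \<open>auto simp: insert_Diff_if\<close>)
  also have "(\<Sum>A\<in>insert x ` Pow S. f A * g (insert x S - A)) =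
      (\<Sum>A\<in>Pow S. f (insert x A) * g (insert x S - insert x A))"
    by (rule sum.reindex_cong[of "insert x"])
       (use assms in \<open>auto simp: inj_on_def insert_ident subset_iff\<close>)
  also have "\<dots> = subset_conv (\<lambda>A. f (insert x A)) g S"
    unfolding subset_conv_def
  proof (rule sum.cong)
    fix A assume "A \<in> Pow S"
    then have "insert x S - insert x A = S - A"
      using assms by auto
    then show "f (insert x A) * g (insert x S - insert x A) = f (insert x A) * g (S - A)"
      by simp
  qed simp
  finally show ?thesis by (simp add: add.commute)
qed

text \<open>Choosing k first and splitting the rest enumerates the same pairs as splitting S first
  and choosing k in the second part. As \<open>g\<close> may depend on k, this applies to sums over
  the label of a root.\<close>

lemma subset_conv_pointed:
  assumes "finite S"
  shows "(\<Sum>k\<in>S. c k * subset_conv f (g k) (S - {k})) =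
    subset_conv f (\<lambda>A. \<Sum>k\<in>A. c k * g k (A - {k})) S"
proof -
  have "(\<Sum>k\<in>S. c k * subset_conv f (g k) (S - {k})) =
      (\<Sum>(k, A)\<in>(SIGMA k:S. Pow (S - {k})). c k * (f A * g k (S - {k} - A)))"
    by (subst sum.Sigma[symmetric])
       (use assms in \<open>auto simp: subset_conv_def sum_distrib_left\<close>)
  also have "\<dots> = (\<Sum>(A, k)\<in>(SIGMA A:Pow S. S - A). f A * (c k * g k (S - A - {k})))"
  proof (rule sum.reindex_bij_witness[of _ prod.swap prod.swap])
    fix p assume "p \<in> (SIGMA k:S. Pow (S - {k}))"
    moreover obtain k A where "p = (k, A)" by force
    moreover have "S - A - {k} = S - {k} - A" by auto
    ultimately show "(case prod.swap p of (A, k) \<Rightarrow> f A * (c k * g k (S - A - {k}))) =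
        (case p of (k, A) \<Rightarrow> c k * (f A * g k (S - {k} - A)))"
      by (simp add: mult_ac)
  qed auto
  also have "\<dots> = subset_conv f (\<lambda>A. \<Sum>k\<in>A. c k * g k (A - {k})) S"
    by (subst sum.Sigma[symmetric])
       (use assms in \<open>auto simp: subset_conv_def sum_distrib_left\<close>)
  finally show ?thesis .
qed

text \<open>The number of subsets of each size cancels the binomial coefficient produced by the
  factorials. The assumption concerns the product of both values, so that one of them may be unknown
  where the other vanishes.\<close>

lemma subset_conv_fps:
  fixes a b :: "'b::field_char_0 fps"
  assumes "finite S"
    and "\<And>A. A \<subseteq> S \<Longrightarrow> f A * g (S - A) =
      fact (card A) * fps_nth a (card A) * (fact (card (S - A)) * fps_nth b (card (S - A)))"
  shows "subset_conv f g S = fact (card S) * fps_nth (a * b) (card S)"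
proof -
  let ?n = "card S"
  have "subset_conv f g S = (\<Sum>A\<in>Pow S. fact ?n / of_nat (?n choose card A) *
      (fps_nth a (card A) * fps_nth b (?n - card A)))"
    unfolding subset_conv_def
  proof (rule sum.cong)
    fix A assume "A \<in> Pow S"
    then have "card A \<le> ?n" "card (S - A) = ?n - card A" "A \<subseteq> S"
      using assms(1) by (auto simp: card_mono card_Diff_subset finite_subset)
    then show "f A * g (S - A) = fact ?n / of_nat (?n choose card A) *
      (fps_nth a (card A) * fps_nth b (?n - card A))"
      using assms(2)[of A] by (simp add: binomial_fact)
  qed simp
  also have "\<dots> = (\<Sum>k\<le>?n. \<Sum>A\<in>{A\<in>Pow S. card A = k}.
      fact ?n / of_nat (?n choose card A) * (fps_nth a (card A) * fps_nth b (?n - card A)))"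
    by (rule sum.group[symmetric]) (use assms(1) in \<open>auto simp: card_mono\<close>)
  also have "\<dots> = (\<Sum>k\<le>?n. fact ?n * (fps_nth a k * fps_nth b (?n - k)))"
  proof (rule sum.cong)
    fix k assume "k \<in> {..?n}"
    have "card {A\<in>Pow S. card A = k} = ?n choose k"
      using n_subsets[OF assms(1), of k] by (simp add: Pow_def)
    moreover have "(of_nat (?n choose k) :: 'b) \<noteq> 0"
      using \<open>k \<in> {..?n}\<close> by simp
    ultimately show "(\<Sum>A\<in>{A\<in>Pow S. card A = k}. fact ?n / of_nat (?n choose card A) *
        (fps_nth a (card A) * fps_nth b (?n - card A))) =
        fact ?n * (fps_nth a k * fps_nth b (?n - k))"
      by simp
  qed simp
  also have "\<dots> = fact ?n * fps_nth (a * b) ?n"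
    by (simp add: fps_mult_nth sum_distrib_left atLeast0AtMost)
  finally show ?thesis .
qed

section \<open>Weighted sums over labelled trees\<close>

definition labelled_trees :: "nat set \<Rightarrow> nat tree set" where
  "labelled_trees S = {t. set_tree t = S \<and> distinct (inorder t)}"

text \<open>The weight of an inner block with label \<open>y\<close> whose nearest cover has label \<open>x\<close>.\<close>

definition edge_weight :: "complex \<Rightarrow> complex \<Rightarrow> nat \<Rightarrow> nat \<Rightarrow> complex" where
  "edge_weight v w x y = (if x < y then v else w)"

text \<open>The right spine carries the outermost blocks, weighted by \<open>ro\<close>. Descending
  to the left enters the inside of x, where the outermost blocks have x as nearest cover.\<close>

fun forest_weight :: "complex \<Rightarrow> complex \<Rightarrow> (nat \<Rightarrow> complex) \<Rightarrow> nat tree \<Rightarrow> complex" where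
  "forest_weight v w ro Leaf = 1"
| "forest_weight v w ro (Node l x r) =
     ro x * forest_weight v w (edge_weight v w x) l * forest_weight v w ro r"

definition forest_sum :: "complex \<Rightarrow> complex \<Rightarrow> (nat \<Rightarrow> complex) \<Rightarrow> nat set \<Rightarrow> complex" where
  "forest_sum v w ro S = (\<Sum>t\<in>labelled_trees S. forest_weight v w ro t)"

text \<open>A tree is here a forest with a single outer block, labelled x; all other labels lie
  inside that block.\<close>

definition tree_sum :: "complex \<Rightarrow> complex \<Rightarrow> (nat \<Rightarrow> complex) \<Rightarrow> nat set \<Rightarrow> complex" where
  "tree_sum v w ro S = (\<Sum>x\<in>S. ro x * forest_sum v w (edge_weight v w x) (S - {x}))"

lemma labelled_trees_empty [simp]: "labelled_trees {} = {Leaf}"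
  by (auto simp: labelled_trees_def)

lemma labelled_trees_Node:
  "Node l x r \<in> labelled_trees S \<longleftrightarrow> (\<exists>A. A \<subseteq> S \<and> x \<in> A \<and>
     l \<in> labelled_trees (A - {x}) \<and> r \<in> labelled_trees (S - A))" (is "?L \<longleftrightarrow> ?R")
proof
  assume ?L
  then show ?R
    by (intro exI[of _ "insert x (set_tree l)"]) (auto simp: labelled_trees_def)
qed (auto simp: labelled_trees_def)

text \<open>A collects the labels of the root and of its left subtree, that is, of the leftmost
  outer block with everything it covers. This indexing turns sums over trees into subset
  convolutions.\<close>

lemma labelled_trees_nonempty:
  assumes "S \<noteq> {}"
  shows "labelled_trees S = (\<lambda>((A, x), (l, r)). Node l x r) `
    (SIGMA (A, x):(SIGMA A:Pow S. A). labelled_trees (A - {x}) \<times> labelled_trees (S - A))"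
    (is "_ = ?f ` ?D")
proof (intro equalityI subsetI)
  fix t assume t: "t \<in> labelled_trees S"
  with assms obtain l x r where "t = Node l x r"
    by (cases t) (auto simp: labelled_trees_def)
  with t obtain A where "((A, x), (l, r)) \<in> ?D" and "t = ?f ((A, x), (l, r))"
    by (auto simp: labelled_trees_Node)
  then show "t \<in> ?f ` ?D" by blast
next
  fix t assume "t \<in> ?f ` ?D"
  then obtain A x l r where "A \<subseteq> S" "x \<in> A" "l \<in> labelled_trees (A - {x})"
      "r \<in> labelled_trees (S - A)" "t = Node l x r"
    by auto
  then show "t \<in> labelled_trees S"
    using labelled_trees_Node by blast
qed

lemma finite_labelled_trees: "finite S \<Longrightarrow> finite (labelled_trees S)"
proof (induction "card S" arbitrary: S rule: less_induct)
  case less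
  show ?case
  proof (cases "S = {}")
    case False
    have "finite (labelled_trees (A - {x}))" "finite (labelled_trees (S - A))"
      if "A \<subseteq> S" "x \<in> A" for A x
    proof -
      have "A - {x} \<subset> S" "S - A \<subset> S" using that by auto
      then have "card (A - {x}) < card S" "card (S - A) < card S"
        using less.prems by (auto intro!: psubset_card_mono)
      moreover have "finite (A - {x})" "finite (S - A)"
        using that less.prems by (auto intro: finite_subset)
      ultimately show "finite (labelled_trees (A - {x}))" "finite (labelled_trees (S - A))"
        by (auto intro: less.hyps)
    qed
    then show ?thesis
      unfolding labelled_trees_nonempty[OF False] using less.prems
      by (intro finite_imageI finite_SigmaI) (auto intro: finite_subset)
  qed simp
qed

lemma forest_sum_cong:
  assumes "\<And>x. x \<in> S \<Longrightarrow> ro x = ro' x"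
  shows "forest_sum v w ro S = forest_sum v w ro' S"
proof -
  have "forest_weight v w ro t = forest_weight v w ro' t" if "set_tree t \<subseteq> S" for t
    using that assms by (induction t) auto
  then show ?thesis
    unfolding forest_sum_def by (intro sum.cong) (auto simp: labelled_trees_def)
qed

lemma forest_sum_nonempty:
  assumes "finite S" "S \<noteq> {}"
  shows "forest_sum v w ro S = subset_conv (tree_sum v w ro) (forest_sum v w ro) S"
proof -
  let ?D = "SIGMA (A, x):(SIGMA A:Pow S. A). labelled_trees (A - {x}) \<times> labelled_trees (S - A)"
  let ?g = "\<lambda>A x l r. ro x * forest_weight v w (edge_weight v w x) l * forest_weight v w ro r"
  have inj: "inj_on (\<lambda>((A, x), (l, r)). Node l x r) ?D"
    by (auto simp: inj_on_def labelled_trees_def)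
  have fin: "finite A" if "A \<subseteq> S" for A
    using assms(1) that by (rule finite_subset[rotated])
  have fin\<Sigma>: "finite (SIGMA A:Pow S. A)"
    using assms(1) fin by auto
  have fin': "finite (labelled_trees (A - {x}) \<times> labelled_trees (S - A))" if "A \<subseteq> S" for A x
    using that assms(1) fin by (intro finite_cartesian_product finite_labelled_trees) auto
  have "forest_sum v w ro S = (\<Sum>p\<in>?D. ?g (fst (fst p)) (snd (fst p)) (fst (snd p)) (snd (snd p)))"
    unfolding forest_sum_def labelled_trees_nonempty[OF assms(2)]
    by (subst sum.reindex[OF inj]) (auto intro!: sum.cong)
  also have "\<dots> = (\<Sum>q\<in>(SIGMA A:Pow S. A).
      \<Sum>t\<in>labelled_trees (fst q - {snd q}) \<times> labelled_trees (S - fst q). ?g (fst q) (snd q) (fst t) (snd t))"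
    by (subst sum.Sigma) (use fin' fin\<Sigma> in \<open>auto simp: case_prod_unfold\<close>)
  also have "\<dots> = (\<Sum>(A, x)\<in>(SIGMA A:Pow S. A).
      \<Sum>(l, r)\<in>labelled_trees (A - {x}) \<times> labelled_trees (S - A). ?g A x l r)"
    by (simp add: case_prod_unfold)
  also have "\<dots> = (\<Sum>A\<in>Pow S. \<Sum>x\<in>A.
      \<Sum>(l, r)\<in>labelled_trees (A - {x}) \<times> labelled_trees (S - A). ?g A x l r)"
    by (subst sum.Sigma) (use assms fin in auto)
  also have "\<dots> = subset_conv (tree_sum v w ro) (forest_sum v w ro) S"
    unfolding subset_conv_def
  proof (rule sum.cong)
    fix A
    have "(\<Sum>(l, r)\<in>labelled_trees (A - {x}) \<times> labelled_trees (S - A). ?g A x l r) =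
        ro x * forest_sum v w (edge_weight v w x) (A - {x}) * forest_sum v w ro (S - A)" for x
      unfolding forest_sum_def mult.assoc sum_product
      by (simp add: sum_distrib_left sum.cartesian_product case_prod_unfold)
    then show "(\<Sum>x\<in>A. \<Sum>(l, r)\<in>labelled_trees (A - {x}) \<times> labelled_trees (S - A). ?g A x l r) =
        tree_sum v w ro A * forest_sum v w ro (S - A)"
      by (simp add: tree_sum_def sum_distrib_right)
  qed simp
  finally show ?thesis .
qed

lemma forest_sum_empty [simp]: "forest_sum v w ro {} = 1"
  by (simp add: forest_sum_def)

lemma tree_sum_empty [simp]: "tree_sum v w ro {} = 0"
  by (simp add: tree_sum_def)

lemma forest_sum_unfold:
  assumes "finite S"
  shows "forest_sum v w ro S = of_bool (S = {}) + subset_conv (tree_sum v w ro) (forest_sum v w ro) S"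
  using forest_sum_nonempty[OF assms] by (cases "S = {}") auto

section \<open>Inserting the block with the largest label\<close>

lemma forest_sum_edge_weight_top:
  assumes "\<And>y. y \<in> S \<Longrightarrow> y < x"
  shows "forest_sum v w (edge_weight v w x) S = forest_sum v w (\<lambda>_. w) S"
  by (rule forest_sum_cong) (use assms in \<open>force simp: edge_weight_def\<close>)

text \<open>Counting gaps between points: a forest has one gap in front,
  \<open>2 * card A - 1\<close> gaps inside the root of its first tree and
  \<open>2 * card (S - A) + 1\<close> in the remaining forest. The unit term is the gap in
  front.\<close>

lemma subset_conv_forest_card:
  assumes "finite S"
  shows "subset_conv (\<lambda>A. of_bool (A = {}) + (2 * of_nat (card A) - 1) * tree_sum v w ro A)
        (forest_sum v w ro) S
     + subset_conv (tree_sum v w ro) (\<lambda>A. (2 * of_nat (card A) + 1) * forest_sum v w ro A) S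
     = (2 * of_nat (card S) + 1) * forest_sum v w ro S"
proof -
  let ?T = "tree_sum v w ro" and ?F = "forest_sum v w ro"
  have "subset_conv (\<lambda>A. (2 * of_nat (card A) - 1) * ?T A) ?F S
      + subset_conv ?T (\<lambda>A. (2 * of_nat (card A) + 1) * ?F A) S
      = (\<Sum>A\<in>Pow S. 2 * of_nat (card S) * (?T A * ?F (S - A)))"
    unfolding subset_conv_def sum.distrib[symmetric]
  proof (rule sum.cong)
    fix A assume "A \<in> Pow S"
    then have "card S = card A + card (S - A)"
      using assms by (metis PowD card_Diff_subset card_mono finite_subset le_add_diff_inverse)
    then show "(2 * of_nat (card A) - 1) * ?T A * ?F (S - A) +
        ?T A * ((2 * of_nat (card (S - A)) + 1) * ?F (S - A)) =
        2 * of_nat (card S) * (?T A * ?F (S - A))"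
      by (simp add: algebra_simps)
  qed simp
  also have "\<dots> = 2 * of_nat (card S) * subset_conv ?T ?F S"
    by (simp add: subset_conv_def sum_distrib_left)
  \<comment> \<open>The factor \<open>card S\<close> removes the empty set, where splitting off a
    first tree fails.\<close>
  also have "\<dots> = 2 * of_nat (card S) * ?F S"
    using forest_sum_nonempty[OF assms, of v w ro] by (cases "S = {}") auto
  finally show ?thesis
    unfolding subset_conv_add_left subset_conv_unit_left[OF assms] distrib_right by simp
qed

text \<open>Either x is the root, and then all its children precede it and carry w, or x lies inside
  the root k, where the forest identity \<open>IH\<close> applies. That identity is an assumption so
  that the lemma can serve both within the induction that proves it and afterwards.\<close>

lemma tree_sum_insert_top_aux:
  assumes "finite S" "\<And>y. y \<in> S \<Longrightarrow> y < x"
    and IH: "\<And>k. k \<in> S \<Longrightarrow> forest_sum v w (edge_weight v w k) (insert x (S - {k})) =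
      v * subset_conv (forest_sum v w (\<lambda>_. w))
        (\<lambda>A. (2 * of_nat (card A) + 1) * forest_sum v w (edge_weight v w k) A) (S - {k})"
  shows "tree_sum v w ro (insert x S) =
    ro x * forest_sum v w (\<lambda>_. w) S +
    v * subset_conv (forest_sum v w (\<lambda>_. w)) (\<lambda>A. (2 * of_nat (card A) - 1) * tree_sum v w ro A) S"
proof -
  let ?N = "forest_sum v w (\<lambda>_. w)"
  let ?D = "\<lambda>k A. (2 * of_nat (card A) + 1) * forest_sum v w (edge_weight v w k) A"
  have x: "x \<notin> S" using assms(2) by blast
  have "tree_sum v w ro (insert x S) = ro x * forest_sum v w (edge_weight v w x) S +
      (\<Sum>k\<in>S. ro k * forest_sum v w (edge_weight v w k) (insert x S - {k}))"
    using assms(1) x by (simp add: tree_sum_def)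
  also have "(\<Sum>k\<in>S. ro k * forest_sum v w (edge_weight v w k) (insert x S - {k})) =
      (\<Sum>k\<in>S. v * (ro k * subset_conv ?N (?D k) (S - {k})))"
  proof (rule sum.cong)
    fix k assume k: "k \<in> S"
    with x have "insert x S - {k} = insert x (S - {k})" by auto
    then show "ro k * forest_sum v w (edge_weight v w k) (insert x S - {k}) =
        v * (ro k * subset_conv ?N (?D k) (S - {k}))"
      using IH[OF k] by simp
  qed simp
  also have "\<dots> = v * subset_conv ?N (\<lambda>A. \<Sum>k\<in>A. ro k * ?D k (A - {k})) S"
    by (simp add: subset_conv_pointed[OF assms(1)] flip: sum_distrib_left)
  also have "subset_conv ?N (\<lambda>A. \<Sum>k\<in>A. ro k * ?D k (A - {k})) S =
      subset_conv ?N (\<lambda>A. (2 * of_nat (card A) - 1) * tree_sum v w ro A) S"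
  proof (rule subset_conv_cong)
    fix A assume "A \<subseteq> S"
    let ?B = "S - A"
    have fin: "finite ?B" using assms(1) by simp
    have "(\<Sum>k\<in>?B. ro k * ?D k (?B - {k})) =
        (\<Sum>k\<in>?B. (2 * of_nat (card ?B) - 1) * (ro k * forest_sum v w (edge_weight v w k) (?B - {k})))"
    proof (rule sum.cong)
      fix k assume k: "k \<in> ?B"
      \<comment> \<open>Putting the root back turns the \<open>2 m + 1\<close> gaps of the forest
        inside it into \<open>2 (m + 1) - 1\<close>.\<close>
      have "card ?B = Suc (card (?B - {k}))"
        using card.remove[OF fin k] .
      then show "ro k * ?D k (?B - {k}) =
         (2 * of_nat (card ?B) - 1) * (ro k * forest_sum v w (edge_weight v w k) (?B - {k}))"
        by simp
    qed simp
    also have "\<dots> = (2 * of_nat (card ?B) - 1) * tree_sum v w ro ?B"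
      unfolding tree_sum_def sum_distrib_left ..
    finally show "?N A * (\<Sum>k\<in>?B. ro k * ?D k (?B - {k})) =
      ?N A * ((2 * of_nat (card ?B) - 1) * tree_sum v w ro ?B)" by simp
  qed
  finally show ?thesis
    using forest_sum_edge_weight_top[OF assms(2), of S v w] by simp
qed

text \<open>
  A forest with \<open>k\<close> blocks inside a fixed block has \<open>2 k + 1\<close> gaps where the block with the
  largest label can be inserted.
\<close>

lemma forest_sum_insert_top:
  assumes "finite S" "\<And>y. y \<in> S \<Longrightarrow> y < x" "k < x"
  shows "forest_sum v w (edge_weight v w k) (insert x S) =
    v * subset_conv (forest_sum v w (\<lambda>_. w))
      (\<lambda>A. (2 * of_nat (card A) + 1) * forest_sum v w (edge_weight v w k) A) S"
  using assms
proof (induction "card S" arbitrary: S k rule: less_induct)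
  case less
  let ?N = "forest_sum v w (\<lambda>_. w)"
  let ?F = "forest_sum v w (edge_weight v w k)" and ?T = "tree_sum v w (edge_weight v w k)"
  let ?D = "\<lambda>A. (2 * of_nat (card A) + 1) * ?F A"
  let ?E = "\<lambda>A. of_bool (A = {}) + (2 * of_nat (card A) - 1) * ?T A"
  have x: "x \<notin> S" using less.prems by blast
  \<comment> \<open>The unit term in \<open>?E\<close> is the case that x is the root of the tree;
    it has weight v because \<open>k < x\<close>, so v can be factored out of both cases.\<close>
  have T: "?T (insert x A) = v * subset_conv ?N ?E A" if "A \<subseteq> S" for A
  proof -
    have fA: "finite A" using that less.prems(1) by (rule finite_subset)
    have "?T (insert x A) = edge_weight v w k x * ?N A +
        v * subset_conv ?N (\<lambda>A. (2 * of_nat (card A) - 1) * ?T A) A"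
    proof (rule tree_sum_insert_top_aux[OF fA])
      fix j assume j: "j \<in> A"
      have "A - {j} \<subset> S" using that j by auto
      then have "card (A - {j}) < card S"
        using less.prems(1) by (intro psubset_card_mono)
      then show "forest_sum v w (edge_weight v w j) (insert x (A - {j})) =
          v * subset_conv ?N (\<lambda>A. (2 * of_nat (card A) + 1) * forest_sum v w (edge_weight v w j) A)
            (A - {j})"
        by (rule less.hyps) (use less.prems that j fA in auto)
    qed (use that less.prems in auto)
    moreover have "subset_conv ?N (\<lambda>A. of_bool (A = {})) A = ?N A"
      by (subst subset_conv_commute) (rule subset_conv_unit_left[OF fA])
    ultimately show ?thesis
      using less.prems(3) by (simp add: edge_weight_def subset_conv_add_right distrib_left)
  qed
  have "?F (insert x S) = subset_conv ?T ?F (insert x S)"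
    using less.prems by (intro forest_sum_nonempty) auto
  also have "\<dots> = subset_conv (\<lambda>A. ?T (insert x A)) ?F S + subset_conv ?T (\<lambda>A. ?F (insert x A)) S"
    by (rule subset_conv_insert[OF less.prems(1) x])
  also have "subset_conv (\<lambda>A. ?T (insert x A)) ?F S = subset_conv (\<lambda>A. v * subset_conv ?N ?E A) ?F S"
    by (rule subset_conv_cong) (simp add: T)
  also have "\<dots> = v * subset_conv ?N (subset_conv ?E ?F) S"
    by (simp add: subset_conv_scale_left subset_conv_assoc[OF less.prems(1)])
  also have "subset_conv ?T (\<lambda>A. ?F (insert x A)) S =
      subset_conv ?T (\<lambda>A. v * subset_conv ?N ?D A) S"
  proof (rule subset_conv_cong)
    fix A assume A: "A \<subseteq> S"
    \<comment> \<open>For empty A the induction hypothesis is out of reach, as \<open>S - A\<close>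
      is all of S, but then \<open>?T A\<close> vanishes.\<close>
    show "?T A * ?F (insert x (S - A)) = ?T A * (v * subset_conv ?N ?D (S - A))"
    proof (cases "A = {}")
      case False
      then have "S - A \<subset> S" using A by auto
      then have "card (S - A) < card S"
        using less.prems(1) by (intro psubset_card_mono)
      then have "?F (insert x (S - A)) = v * subset_conv ?N ?D (S - A)"
        by (rule less.hyps) (use less.prems in auto)
      then show ?thesis by simp
    qed simp
  qed
  also have "\<dots> = v * subset_conv ?N (subset_conv ?T ?D) S"
    unfolding subset_conv_scale_right
    by (subst (1 2) subset_conv_assoc[OF less.prems(1), symmetric])
       (auto simp: subset_conv_commute[of ?T ?N] intro!: arg_cong[where f = "(*) v"] subset_conv_cong)
  \<comment> \<open>Whether x falls into the first tree or into a later one, its inside contributes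
    the same factor \<open>?N\<close>; what remains is the gap count of a forest.\<close>
  also have "v * subset_conv ?N (subset_conv ?E ?F) S + v * subset_conv ?N (subset_conv ?T ?D) S =
      v * subset_conv ?N (\<lambda>A. subset_conv ?E ?F A + subset_conv ?T ?D A) S"
    by (simp add: subset_conv_add_right distrib_left)
  also have "subset_conv ?N (\<lambda>A. subset_conv ?E ?F A + subset_conv ?T ?D A) S = subset_conv ?N ?D S"
    by (rule subset_conv_cong) (use less.prems(1) in \<open>simp add: subset_conv_forest_card\<close>)
  finally show ?case .
qed

text \<open>The differential equation for T at the level of label sets: adjoining the largest label
  plays the part of the derivative. As a root, x now has weight 1, hence no v at the unit
  term.\<close>

lemma tree_sum_insert_top:
  assumes "finite S" "\<And>y. y \<in> S \<Longrightarrow> y < x"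
  shows "tree_sum v w (\<lambda>_. 1) (insert x S) = subset_conv (forest_sum v w (\<lambda>_. w))
    (\<lambda>A. of_bool (A = {}) + v * ((2 * of_nat (card A) - 1) * tree_sum v w (\<lambda>_. 1) A)) S"
proof -
  have "subset_conv (forest_sum v w (\<lambda>_. w)) (\<lambda>A. of_bool (A = {})) S = forest_sum v w (\<lambda>_. w) S"
    by (subst subset_conv_commute) (rule subset_conv_unit_left[OF assms(1)])
  moreover have "tree_sum v w (\<lambda>_. 1) (insert x S) = 1 * forest_sum v w (\<lambda>_. w) S +
    v * subset_conv (forest_sum v w (\<lambda>_. w))
      (\<lambda>A. (2 * of_nat (card A) - 1) * tree_sum v w (\<lambda>_. 1) A) S"
    by (rule tree_sum_insert_top_aux) (use assms in \<open>auto intro!: forest_sum_insert_top\<close>)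
  ultimately show ?thesis
    by (simp add: subset_conv_add_right subset_conv_scale_right)
qed

lemma tree_sum_const: "tree_sum v w (\<lambda>_. u) S = u * tree_sum v w (\<lambda>_. 1) S"
  by (simp add: tree_sum_def sum_distrib_left)

section \<open>Generating functions\<close>

text \<open>The series of \<open>sqrt (1 - c t)\<close>, where \<open>fps_X\<close> is t.\<close>

definition sqrt_series :: "'a::field_char_0 \<Rightarrow> 'a fps" where
  "sqrt_series c = fps_binomial (1/2) oo (fps_const (- c) * fps_X)"

lemma sqrt_series_nth_0 [simp]: "fps_nth (sqrt_series c) 0 = 1"
  by (simp add: sqrt_series_def)

lemma sqrt_series_square: "sqrt_series c ^ 2 = 1 - fps_const c * fps_X"
proof -
  have "fps_binomial (1/2 :: 'a) ^ 2 = fps_binomial 1"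
    by (simp add: power2_eq_square flip: fps_binomial_add_mult)
  also have "\<dots> = 1 + fps_X"
    by (simp add: fps_binomial_1)
  finally have "sqrt_series c ^ 2 = (1 + fps_X) oo (fps_const (- c) * fps_X)"
    by (simp add: sqrt_series_def fps_compose_power)
  also have "\<dots> = 1 - fps_const c * fps_X"
    by (simp add: fps_compose_add_distrib flip: fps_const_neg)
  finally show ?thesis .
qed

text \<open>Closed form for the exponential generating function of \<open>tree_sum\<close> with root
  weight 1. It involves v and w only through \<open>c = v + w\<close>.\<close>

definition tree_series :: "'a::field_char_0 \<Rightarrow> 'a fps" where
  "tree_series c = fps_const (1 / c) * (1 - sqrt_series (2 * c))"

lemma tree_series_nth_0 [simp]: "fps_nth (tree_series c) 0 = 0"
  by (simp add: tree_series_def)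

text \<open>With R the square root and K the tree series, differentiating
  \<open>R^2 = 1 - 2 c t\<close> gives \<open>R R' = - c\<close>, while
  \<open>K' = - R' / c\<close>.\<close>

lemma sqrt_series_times_deriv_tree_series:
  fixes c :: "'a::field_char_0"
  assumes "c \<noteq> 0"
  shows "sqrt_series (2 * c) * fps_deriv (tree_series c) = 1"
proof -
  have "fps_deriv (sqrt_series (2 * c) ^ 2) = fps_deriv (1 - fps_const (2 * c) * fps_X)"
    by (simp add: sqrt_series_square)
  then have "2 * (sqrt_series (2 * c) * fps_deriv (sqrt_series (2 * c))) = - (2 * fps_const c)"
    by (simp add: power2_eq_square mult_ac flip: fps_const_mult fps_numeral_fps_const)
  then have "2 * (sqrt_series (2 * c) * fps_deriv (sqrt_series (2 * c)) + fps_const c) = 0"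
    by (simp add: distrib_left)
  then have "sqrt_series (2 * c) * fps_deriv (sqrt_series (2 * c)) + fps_const c = 0"
    by (simp only: mult_eq_0_iff) simp
  then have "sqrt_series (2 * c) * fps_deriv (sqrt_series (2 * c)) = - fps_const c"
    by (simp only: eq_neg_iff_add_eq_0)
  then have "sqrt_series (2 * c) * fps_deriv (tree_series c) = fps_const (1 / c) * fps_const c"
    by (simp add: tree_series_def mult.left_commute)
  with assms show ?thesis by simp
qed

text \<open>Multiplying the algebraic identity \<open>1 - w K = R (1 - v K) + 2 v t\<close> by
  \<open>K'\<close> and using \<open>R K' = 1\<close> gives the equation.\<close>

lemma tree_series_ode:
  fixes v w :: "'a::field_char_0"
  assumes "v + w \<noteq> 0"
  defines "K \<equiv> tree_series (v + w)"
  shows "(1 - fps_const w * K) * fps_deriv K =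
    1 + fps_const v * (2 * fps_X * fps_deriv K - K)"
proof -
  define c where "c = v + w"
  define R where "R = sqrt_series (2 * c)"
  have c: "fps_const c \<noteq> 0" and cvw: "fps_const c = fps_const v + fps_const w"
    using assms by (auto simp: c_def)
  have R: "R \<noteq> 0" by (auto simp: R_def fps_eq_iff intro!: exI[of _ 0])
  have RK: "R * fps_deriv K = 1"
    using sqrt_series_times_deriv_tree_series[OF assms(1)] by (simp add: R_def K_def c_def)
  have "fps_const c * fps_const (1 / c) = 1"
    using c by simp
  then have cK: "fps_const c * K = 1 - R"
    by (simp add: K_def tree_series_def R_def c_def mult.assoc[symmetric] del: fps_const_mult)
  have R2: "R * R = 1 - 2 * fps_const c * fps_X"
    using sqrt_series_square[of "2 * c"]
    by (simp add: R_def power2_eq_square fps_numeral_fps_const)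
  \<comment> \<open>The factor c allows \<open>c K\<close> to be replaced by \<open>1 - R\<close>;
    both sides then equal \<open>v + w R\<close>, since \<open>1 - R^2 = 2 c t\<close>.\<close>
  have "fps_const c * (1 - fps_const w * K) = fps_const c * (R * (1 - fps_const v * K) + 2 * fps_const v * fps_X)"
  proof -
    have "fps_const c * (1 - fps_const w * K) = fps_const c - fps_const w * (fps_const c * K)"
      by (simp add: algebra_simps)
    also have "\<dots> = fps_const v + fps_const w * R"
      unfolding cK unfolding cvw by (simp add: algebra_simps del: fps_const_add)
    also have "\<dots> = fps_const c * R - fps_const v * R * (1 - R) + fps_const v * (1 - R * R)"
      unfolding cvw by (simp add: algebra_simps del: fps_const_add)
    also have "\<dots> = fps_const c * (R * (1 - fps_const v * K) + 2 * fps_const v * fps_X)"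
      unfolding cK[symmetric] R2 by (simp add: algebra_simps)
    finally show ?thesis .
  qed
  with c have eq: "1 - fps_const w * K = R * (1 - fps_const v * K) + 2 * fps_const v * fps_X"
    by simp
  have "(1 - fps_const w * K) * fps_deriv K =
      (1 - fps_const v * K) * (R * fps_deriv K) + 2 * fps_const v * fps_X * fps_deriv K"
    unfolding eq by (simp add: algebra_simps)
  then show ?thesis
    unfolding RK by (simp add: algebra_simps)
qed

definition forest_series :: "'a::field_char_0 \<Rightarrow> 'a \<Rightarrow> 'a fps" where
  "forest_series c u = inverse (1 - fps_const u * tree_series c)"

lemma forest_series_times: "(1 - fps_const u * tree_series c) * forest_series c u = 1"
  unfolding forest_series_def by (rule inverse_mult_eq_1') simp

lemma forest_series_unfold:
  "forest_series c u = 1 + fps_const u * tree_series c * forest_series c u"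
  using forest_series_times[of u c] by (simp add: left_diff_distrib algebra_simps)

text \<open>The equation solved for \<open>K'\<close>, with \<open>1 / (1 - w K)\<close> as a forest
  series, to match the convolution in \<open>tree_sum_insert_top\<close>. Coefficient n on the right
  involves K only up to index n, so the equation determines K recursively.\<close>

lemma fps_deriv_tree_series:
  assumes "v + w \<noteq> 0"
  defines "K \<equiv> tree_series (v + w)"
  shows "fps_deriv K = forest_series (v + w) w *
    (1 + fps_const v * (2 * fps_X * fps_deriv K - K))"
proof -
  have "fps_deriv K = (1 - fps_const w * K) * forest_series (v + w) w * fps_deriv K"
    unfolding K_def forest_series_times by simp
  also have "\<dots> = forest_series (v + w) w * ((1 - fps_const w * K) * fps_deriv K)"
    by (simp add: mult_ac)
  finally show ?thesis
    unfolding K_def tree_series_ode[OF assms(1)] .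
qed

section \<open>Tree and forest sums as coefficients\<close>

lemma forest_sum_fps_step:
  assumes "finite S"
    and T: "\<And>A. A \<subseteq> S \<Longrightarrow> tree_sum v w (\<lambda>_. 1) A = fact (card A) * fps_nth (tree_series c) (card A)"
    and F: "\<And>A. A \<subset> S \<Longrightarrow> forest_sum v w (\<lambda>_. u) A = fact (card A) * fps_nth (forest_series c u) (card A)"
  shows "forest_sum v w (\<lambda>_. u) S = fact (card S) * fps_nth (forest_series c u) (card S)"
proof -
  have "forest_sum v w (\<lambda>_. u) S =
      of_bool (S = {}) + subset_conv (tree_sum v w (\<lambda>_. u)) (forest_sum v w (\<lambda>_. u)) S"
    by (rule forest_sum_unfold[OF assms(1)])
  also have "subset_conv (tree_sum v w (\<lambda>_. u)) (forest_sum v w (\<lambda>_. u)) S =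
      fact (card S) * fps_nth (fps_const u * tree_series c * forest_series c u) (card S)"
  proof (rule subset_conv_fps[OF assms(1)])
    fix A assume A: "A \<subseteq> S"
    show "tree_sum v w (\<lambda>_. u) A * forest_sum v w (\<lambda>_. u) (S - A) =
        fact (card A) * fps_nth (fps_const u * tree_series c) (card A) *
        (fact (card (S - A)) * fps_nth (forest_series c u) (card (S - A)))"
    \<comment> \<open>The forest sum is known on proper subsets only. The remaining term, with empty
      A, is zero on both sides because trees are nonempty.\<close>
    proof (cases "A = {}")
      case False
      with A have "S - A \<subset> S" by auto
      then show ?thesis
        using F[of "S - A"] T[OF A] by (simp add: tree_sum_const[of v w u A])
    qed simp
  qed
  also have "of_bool (S = {}) = (fact (card S) * fps_nth 1 (card S) :: complex)"
    using assms(1) by auto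
  finally show ?thesis
    by (subst forest_series_unfold) (simp add: distrib_left)
qed

text \<open>Both claims need one joint induction: removing the largest label expresses T on S
  through T and N on proper subsets, and N on S then follows from T on S and N on proper
  subsets.\<close>

lemma forest_tree_sum_fps:
  assumes "v + w \<noteq> 0" "finite S"
  shows "tree_sum v w (\<lambda>_. 1) S = fact (card S) * fps_nth (tree_series (v + w)) (card S)
    \<and> forest_sum v w (\<lambda>_. w) S = fact (card S) * fps_nth (forest_series (v + w) w) (card S)"
  using assms(2)
proof (induction "card S" arbitrary: S rule: less_induct)
  case less
  let ?K = "tree_series (v + w)" and ?N = "forest_series (v + w) w"
  have IH: "tree_sum v w (\<lambda>_. 1) A = fact (card A) * fps_nth ?K (card A)"
    "forest_sum v w (\<lambda>_. w) A = fact (card A) * fps_nth ?N (card A)" if "A \<subset> S" for A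
    using less.hyps[of A] less.prems that
    by (auto simp: psubset_card_mono intro: finite_subset)
  have "tree_sum v w (\<lambda>_. 1) S = fact (card S) * fps_nth ?K (card S)"
  proof (cases "S = {}")
    case False
    define x where "x = Max S"
    define S' where "S' = S - {x}"
    have S: "S = insert x S'" and x: "x \<notin> S'" and fin: "finite S'"
      using less.prems Max_in[OF less.prems False] by (auto simp: S'_def x_def)
    then have cardS: "card S = Suc (card S')" by simp
    have top: "y < x" if "y \<in> S'" for y
    proof -
      have "y \<in> S" "y \<noteq> x" using that by (auto simp: S'_def)
      moreover have "y \<le> x"
        unfolding x_def by (rule Max_ge[OF less.prems]) fact
      ultimately show ?thesis by simp
    qed
    have "tree_sum v w (\<lambda>_. 1) S = subset_conv (forest_sum v w (\<lambda>_. w)) (\<lambda>A. of_bool (A = {}) +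
        v * ((2 * of_nat (card A) - 1) * tree_sum v w (\<lambda>_. 1) A)) S'"
      unfolding S by (rule tree_sum_insert_top) (use fin top in auto)
    also have "\<dots> = fact (card S') *
        fps_nth (?N * (1 + fps_const v * (2 * fps_X * fps_deriv ?K - ?K))) (card S')"
    proof (rule subset_conv_fps[OF fin])
      fix A assume A: "A \<subseteq> S'"
      let ?B = "S' - A"
      have sub: "A \<subset> S" "?B \<subset> S" using A S x by auto
      have XD: "fps_nth (fps_X * fps_deriv ?K) n = of_nat n * fps_nth ?K n" for n
        by (cases n) auto
      have double: "2 * fps_X * fps_deriv ?K = fps_X * fps_deriv ?K + fps_X * fps_deriv ?K"
        by simp
      have coeff: "fps_nth (1 + fps_const v * (2 * fps_X * fps_deriv ?K - ?K)) n =
          of_bool (n = 0) + v * ((2 * of_nat n - 1) * fps_nth ?K n)" for n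
        unfolding double fps_add_nth fps_mult_left_const_nth fps_sub_nth XD
        by (simp add: left_diff_distrib)
      have "of_bool (B = {}) + v * ((2 * of_nat (card B) - 1) * (fact (card B) * fps_nth ?K (card B))) =
          fact (card B) * (of_bool (card B = 0) + v * ((2 * of_nat (card B) - 1) * fps_nth ?K (card B)))"
        if "finite B" for B :: "nat set"
        using that by (cases "B = {}") (auto simp: algebra_simps)
      note step = this[of ?B]
      show "forest_sum v w (\<lambda>_. w) A * (of_bool (?B = {}) +
          v * ((2 * of_nat (card ?B) - 1) * tree_sum v w (\<lambda>_. 1) ?B)) =
          fact (card A) * fps_nth ?N (card A) * (fact (card ?B) *
          fps_nth (1 + fps_const v * (2 * fps_X * fps_deriv ?K - ?K)) (card ?B))"
        unfolding IH(2)[OF sub(1)] IH(1)[OF sub(2)] coeff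
        by (subst step) (use fin in simp_all)
    qed
    also have "\<dots> = fact (card S') * fps_nth (fps_deriv ?K) (card S')"
      by (subst (2) fps_deriv_tree_series[OF assms(1)]) simp
    also have "\<dots> = fact (card S) * fps_nth ?K (card S)"
      unfolding cardS by (simp add: algebra_simps)
    finally show ?thesis .
  qed simp
  moreover from this have "forest_sum v w (\<lambda>_. w) S = fact (card S) * fps_nth ?N (card S)"
  proof (intro forest_sum_fps_step[OF less.prems])
    fix A assume "A \<subseteq> S"
    then show "tree_sum v w (\<lambda>_. 1) A = fact (card A) * fps_nth ?K (card A)"
      using IH(1)[of A] \<open>tree_sum v w (\<lambda>_. 1) S = fact (card S) * fps_nth ?K (card S)\<close>
      by (cases "A = S") auto
  qed (rule IH(2))
  ultimately show ?case by blast
qed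

text \<open>Tree sums with root weight 1 do not involve the outer weight, so their closed form,
  found along with the outer weight w, serves for every u.\<close>

lemma forest_sum_fps:
  assumes "v + w \<noteq> 0" "finite S"
  shows "forest_sum v w (\<lambda>_. u) S = fact (card S) * fps_nth (forest_series (v + w) u) (card S)"
  using assms(2)
proof (induction S rule: finite_psubset_induct)
  case (psubset S)
  show ?case
  proof (rule forest_sum_fps_step)
    fix A assume "A \<subseteq> S"
    then have "finite A" using psubset.hyps by (rule finite_subset)
    then show "tree_sum v w (\<lambda>_. 1) A = fact (card A) * fps_nth (tree_series (v + w)) (card A)"
      using forest_tree_sum_fps[OF assms(1)] by blast
  qed (use psubset in auto)
qed

section \<open>Trees and noncrossing pair partitions\<close>

text \<open>
  \<open>arc a t s\<close> is the block labelled \<open>s\<close> when \<open>t\<close> is drawn on the points from \<open>a\<close> on;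
  \<open>parent t s\<close> is the label of its nearest cover.
\<close>

fun arc :: "nat \<Rightarrow> nat tree \<Rightarrow> nat \<Rightarrow> nat set" where
  "arc a Leaf s = {}"
| "arc a (Node l x r) s =
     (if s = x then {a, a + 2 * size l + 1}
      else if s \<in> set_tree l then arc (a + 1) l s
      else arc (a + 2 * size l + 2) r s)"

fun parent :: "nat tree \<Rightarrow> nat \<Rightarrow> nat option" where
  "parent Leaf s = None"
| "parent (Node l x r) s =
     (if s \<in> set_tree l then (case parent l s of None \<Rightarrow> Some x | Some y \<Rightarrow> Some y)
      else parent r s)"

text \<open>Only the nodes at which the path to s turns left count: those blocks enclose s, whereas
  a right turn merely passes on to the next sibling.\<close>

fun ancestor :: "nat tree \<Rightarrow> nat \<Rightarrow> nat \<Rightarrow> bool" where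
  "ancestor Leaf y s \<longleftrightarrow> False"
| "ancestor (Node l x r) y s \<longleftrightarrow>
     (if s \<in> set_tree l then y = x \<or> ancestor l y s else ancestor r y s)"

lemma size_eq_card_set_tree: "distinct (inorder t) \<Longrightarrow> size t = card (set_tree t)"
  by (metis distinct_card length_inorder set_inorder)

lemma ancestor_mem: "ancestor t y s \<Longrightarrow> y \<in> set_tree t \<and> s \<in> set_tree t"
  by (induction t) (auto split: if_splits)

lemma parent_not_mem: "s \<notin> set_tree t \<Longrightarrow> parent t s = None"
  by (induction t) auto

lemma parent_None_iff: "parent t s = None \<longleftrightarrow> (\<forall>y. \<not> ancestor t y s)"
  by (induction t) (auto split: option.splits)

text \<open>The parent is the lowest ancestor; this is the tree form of the uniqueness of the
  nearest cover.\<close>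

lemma parent_SomeD:
  assumes "distinct (inorder t)" "parent t s = Some x"
  shows "ancestor t x s \<and> (\<forall>y. ancestor t y s \<longrightarrow> y = x \<or> ancestor t y x)"
  using assms
proof (induction t)
  case (Node l z r)
  show ?case
  proof (cases "s \<in> set_tree l")
    case True
    show ?thesis
    proof (cases "parent l s")
      case None
      then have "\<not> ancestor l y s" for y
        using parent_None_iff by blast
      then show ?thesis
        using None True Node.prems by auto
    next
      case (Some y)
      then have "ancestor l x s \<and> (\<forall>y. ancestor l y s \<longrightarrow> y = x \<or> ancestor l y x)"
        using True Node by auto
      then show ?thesis
        using True ancestor_mem[of l x s] by auto
    qed
  next
    case False
    then have r: "ancestor r x s \<and> (\<forall>y. ancestor r y s \<longrightarrow> y = x \<or> ancestor r y x)"
      using Node by auto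
    then have "x \<notin> set_tree l"
      using ancestor_mem[of r x s] Node.prems(1) by auto
    then show ?thesis using r False by auto
  qed
qed simp

text \<open>A block without parent in the left subtree acquires x as its parent in the whole tree,
  which is where the recursion replaces \<open>ro\<close> by the edge weight of x.\<close>

lemma forest_weight_eq_prod:
  assumes "distinct (inorder t)"
  shows "forest_weight v w ro t =
    (\<Prod>s\<in>set_tree t. case parent t s of None \<Rightarrow> ro s | Some x \<Rightarrow> edge_weight v w x s)"
  using assms
proof (induction t arbitrary: ro)
  case (Node l x r)
  let ?g = "\<lambda>s. case parent (Node l x r) s of None \<Rightarrow> ro s | Some y \<Rightarrow> edge_weight v w y s"
  have x: "x \<notin> set_tree l \<union> set_tree r" and lr: "set_tree l \<inter> set_tree r = {}"
    using Node.prems by auto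
  have "(\<Prod>s\<in>set_tree (Node l x r). ?g s) = ?g x * ((\<Prod>s\<in>set_tree l. ?g s) * (\<Prod>s\<in>set_tree r. ?g s))"
    using x lr by (simp add: prod.union_disjoint)
  also have "?g x = ro x"
    using x by (simp add: parent_not_mem)
  also have "(\<Prod>s\<in>set_tree l. ?g s) = forest_weight v w (edge_weight v w x) l"
    using Node by (auto intro!: prod.cong split: option.splits)
  also have "(\<Prod>s\<in>set_tree r. ?g s) = forest_weight v w ro r"
    using Node lr by (auto intro!: prod.cong)
  finally show ?case by (simp add: mult.assoc)
qed simp

section \<open>Arcs drawn by a tree\<close>

lemma arc_eq_pair:
  assumes "s \<in> set_tree t"
  obtains i j where "arc a t s = {i, j}" "a \<le> i" "i < j" "j < a + 2 * size t"
proof -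
  have "\<exists>i j. arc a t s = {i, j} \<and> a \<le> i \<and> i < j \<and> j < a + 2 * size t"
    using assms
  proof (induction t arbitrary: a)
    case (Node l x r)
    consider "s = x" | "s \<noteq> x" "s \<in> set_tree l" | "s \<noteq> x" "s \<notin> set_tree l" "s \<in> set_tree r"
      using Node.prems by auto
    then show ?case
    proof cases
      case 1
      then show ?thesis
        by (intro exI[of _ a] exI[of _ "a + 2 * size l + 1"]) simp
    next
      case 2
      with Node.IH(1)[of "a + 1"] obtain i j where
        "arc (a + 1) l s = {i, j}" "a + 1 \<le> i" "i < j" "j < a + 1 + 2 * size l" by blast
      with 2 show ?thesis by (intro exI[of _ i] exI[of _ j]) simp
    next
      case 3
      with Node.IH(2)[of "a + 2 * size l + 2"] obtain i j where
        "arc (a + 2 * size l + 2) r s = {i, j}" "a + 2 * size l + 2 \<le> i" "i < j"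
        "j < a + 2 * size l + 2 + 2 * size r" by blast
      with 3 show ?thesis by (intro exI[of _ i] exI[of _ j]) simp
    qed
  qed simp
  then show thesis using that by blast
qed

lemma arc_nonempty: "s \<in> set_tree t \<Longrightarrow> arc a t s \<noteq> {}"
  by (metis arc_eq_pair insert_not_empty)

lemma card_arc: "s \<in> set_tree t \<Longrightarrow> card (arc a t s) = 2"
  by (rule arc_eq_pair[of s t a]) auto

lemma arc_subset: "s \<in> set_tree t \<Longrightarrow> arc a t s \<subseteq> {a..<a + 2 * size t}"
  by (rule arc_eq_pair[of s t a]) auto

lemma Union_arc: "distinct (inorder t) \<Longrightarrow> (\<Union>s\<in>set_tree t. arc a t s) = {a..<a + 2 * size t}"
proof (induction t arbitrary: a)
  case (Node l x r)
  have "(\<Union>s\<in>set_tree (Node l x r). arc a (Node l x r) s) = {a, a + 2 * size l + 1} \<union>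
      (\<Union>s\<in>set_tree l. arc (a + 1) l s) \<union> (\<Union>s\<in>set_tree r. arc (a + 2 * size l + 2) r s)"
    using Node.prems by (auto split: if_splits)
  also have "\<dots> = {a, a + 2 * size l + 1} \<union> {a + 1..<a + 1 + 2 * size l} \<union>
      {a + 2 * size l + 2..<a + 2 * size l + 2 + 2 * size r}"
    using Node by simp
  also have "\<dots> = {a..<a + 2 * size (Node l x r)}"
    by auto
  finally show ?case .
qed simp

definition crossing :: "nat set \<Rightarrow> nat set \<Rightarrow> bool" where
  "crossing A B \<longleftrightarrow> (\<exists>i\<in>A. \<exists>j\<in>B. \<exists>k\<in>A. \<exists>l\<in>B. i < j \<and> j < k \<and> k < l)"

lemma noncrossing_iff: "noncrossing P \<longleftrightarrow> (\<forall>A\<in>P. \<forall>B\<in>P. A \<noteq> B \<longrightarrow> \<not> crossing A B)"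
proof -
  have "noncrossing P \<longleftrightarrow> \<not> (\<exists>A\<in>P. \<exists>B\<in>P. A \<noteq> B \<and> crossing A B)"
    by (simp only: noncrossing_def crossing_def)
  then show ?thesis by blast
qed

lemma crossing_pair:
  assumes "i < k" "j < l"
  shows "crossing {i, k} {j, l} \<longleftrightarrow> i < j \<and> j < k \<and> k < l"
  using assms by (auto simp: crossing_def)

lemma covers_pair:
  assumes "i < j" "k < l"
  shows "covers {i, j} {k, l} \<longleftrightarrow> i < k \<and> l < j"
  using assms by (auto simp: covers_def)

text \<open>One induction serves all three facts, since they rest on the same comparison of
  positions: arcs of the left subtree lie strictly between the ends of the root arc, and arcs of the
  right subtree lie beyond it.\<close>

lemma arc_relations:
  assumes "distinct (inorder t)" "s \<in> set_tree t" "y \<in> set_tree t"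
  shows "\<not> crossing (arc a t s) (arc a t y) \<and> (s \<noteq> y \<longrightarrow> arc a t s \<inter> arc a t y = {}) \<and>
    (covers (arc a t y) (arc a t s) \<longleftrightarrow> ancestor t y s)"
  using assms
proof (induction t arbitrary: a)
  case (Node l x r)
  let ?t = "Node l x r"
  have l: "arc a ?t z = arc (a + 1) l z" if "z \<in> set_tree l" for z
    using that Node.prems(1) by auto
  have r: "arc a ?t z = arc (a + 2 * size l + 2) r z" if "z \<in> set_tree r" for z
    using that Node.prems(1) by auto
  have IHl: ?case if "s \<in> set_tree l" "y \<in> set_tree l"
  proof -
    have "y \<noteq> x" using that Node.prems(1) by auto
    then show ?thesis
      unfolding l[OF that(1)] l[OF that(2)] using Node.IH(1)[of "a + 1"] Node.prems(1) that by simp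
  qed
  have IHr: ?case if "s \<in> set_tree r" "y \<in> set_tree r"
  proof -
    have "s \<notin> set_tree l" using that Node.prems(1) by auto
    then show ?thesis
      unfolding r[OF that(1)] r[OF that(2)]
      using Node.IH(2)[of "a + 2 * size l + 2"] Node.prems(1) that by simp
  qed
  have split: "(z = x \<and> arc a ?t z = {a, a + 2 * size l + 1}) \<or>
      (z \<in> set_tree l \<and> (\<exists>i j. arc a ?t z = {i, j} \<and> a < i \<and> i < j \<and> j < a + 2 * size l + 1)) \<or>
      (z \<in> set_tree r \<and> (\<exists>i j. arc a ?t z = {i, j} \<and> a + 2 * size l + 1 < i \<and> i < j))"
    if z: "z \<in> set_tree ?t" for z
  proof -
    consider "z = x" | "z \<in> set_tree l" | "z \<in> set_tree r" using z by auto
    then show ?thesis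
    proof cases
      case 1
      then show ?thesis by simp
    next
      case 2
      from arc_eq_pair[OF this, of "a + 1"] obtain i j where
        "arc (a + 1) l z = {i, j}" "a + 1 \<le> i" "i < j" "j < a + 1 + 2 * size l" .
      then have "arc a ?t z = {i, j} \<and> a < i \<and> i < j \<and> j < a + 2 * size l + 1"
        unfolding l[OF 2] by simp
      then show ?thesis using 2 by blast
    next
      case 3
      from arc_eq_pair[OF this, of "a + 2 * size l + 2"] obtain i j where
        "arc (a + 2 * size l + 2) r z = {i, j}" "a + 2 * size l + 2 \<le> i" "i < j" .
      then have "arc a ?t z = {i, j} \<and> a + 2 * size l + 1 < i \<and> i < j"
        unfolding r[OF 3] by simp
      then show ?thesis using 3 by blast
    qed
  qed
  consider
      (ll) "s \<in> set_tree l" "y \<in> set_tree l" | (rr) "s \<in> set_tree r" "y \<in> set_tree r"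
    | (xx) "s = x" "y = x"
    | (xl) j k where "s = x" "y \<in> set_tree l" "arc a ?t s = {a, a + 2 * size l + 1}"
        "arc a ?t y = {j, k}" "a < j" "j < k" "k < a + 2 * size l + 1"
    | (xr) j k where "s = x" "y \<in> set_tree r" "arc a ?t s = {a, a + 2 * size l + 1}"
        "arc a ?t y = {j, k}" "a + 2 * size l + 1 < j" "j < k"
    | (lx) j k where "y = x" "s \<in> set_tree l" "arc a ?t y = {a, a + 2 * size l + 1}"
        "arc a ?t s = {j, k}" "a < j" "j < k" "k < a + 2 * size l + 1"
    | (rx) j k where "y = x" "s \<in> set_tree r" "arc a ?t y = {a, a + 2 * size l + 1}"
        "arc a ?t s = {j, k}" "a + 2 * size l + 1 < j" "j < k"
    | (lr) i j k m where "s \<in> set_tree l" "y \<in> set_tree r" "arc a ?t s = {i, j}"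
        "arc a ?t y = {k, m}" "i < j" "j < a + 2 * size l + 1" "a + 2 * size l + 1 < k" "k < m"
    | (rl) i j k m where "y \<in> set_tree l" "s \<in> set_tree r" "arc a ?t y = {i, j}"
        "arc a ?t s = {k, m}" "i < j" "j < a + 2 * size l + 1" "a + 2 * size l + 1 < k" "k < m"
    using split[OF Node.prems(2)] split[OF Node.prems(3)]
    by (elim disjE conjE exE) (rule that; assumption)+
  then show ?case
  proof cases
    case xx
    then show ?thesis
      using Node.prems(1) ancestor_mem[of r x x]
      by (auto simp: crossing_def covers_def)
  next
    case xl
    then have "x \<notin> set_tree l" "\<not> ancestor r y x"
      using Node.prems(1) ancestor_mem[of r y x] by auto
    with xl show ?thesis
      by (simp add: crossing_pair covers_pair del: arc.simps)
  next
    case xr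
    then have "x \<notin> set_tree l" "\<not> ancestor r y x"
      using Node.prems(1) ancestor_mem[of r y x] by auto
    with xr show ?thesis
      by (simp add: crossing_pair covers_pair del: arc.simps)
  next
    case lx
    then show ?thesis
      by (simp add: crossing_pair covers_pair del: arc.simps)
  next
    case rx
    then have "s \<notin> set_tree l" "\<not> ancestor r x s"
      using Node.prems(1) ancestor_mem[of r x s] by auto
    with rx show ?thesis
      by (simp add: crossing_pair covers_pair del: arc.simps)
  next
    case lr
    then have "y \<noteq> x" "\<not> ancestor l y s"
      using Node.prems(1) ancestor_mem[of l y s] by auto
    with lr show ?thesis
      by (simp add: crossing_pair covers_pair del: arc.simps)
  next
    case rl
    then have "s \<notin> set_tree l" "\<not> ancestor r y s"
      using Node.prems(1) ancestor_mem[of r y s] by auto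
    with rl show ?thesis
      by (simp add: crossing_pair covers_pair del: arc.simps)
  qed (use IHl IHr in blast)+
qed simp

lemmas arc_not_crossing = arc_relations[THEN conjunct1]
lemmas arc_disjoint = arc_relations[THEN conjunct2, THEN conjunct1, rule_format]
lemmas covers_arc_iff = arc_relations[THEN conjunct2, THEN conjunct2]

lemma arc_subset_left_iff:
  assumes "distinct (inorder (Node l x r))" "s \<in> set_tree (Node l x r)"
  shows "s \<in> set_tree l \<longleftrightarrow> arc a (Node l x r) s \<subseteq> {a + 1..a + 2 * size l}"
proof -
  consider "s = x" "s \<notin> set_tree l" | "s \<in> set_tree l" "s \<noteq> x"
    | "s \<in> set_tree r" "s \<notin> set_tree l" "s \<noteq> x"
    using assms by auto
  then show ?thesis
  proof cases
    case 2
    then show ?thesis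
      using arc_subset[of s l "a + 1"] by auto
  next
    case 3
    obtain i j where "arc (a + 2 * size l + 2) r s = {i, j}" "a + 2 * size l + 2 \<le> i"
      using arc_eq_pair[OF 3(1)] by metis
    then show ?thesis using 3 by simp
  qed simp
qed

lemma arc_root_iff:
  assumes "distinct (inorder (Node l x r))" "s \<in> set_tree (Node l x r)"
  shows "a \<in> arc a (Node l x r) s \<longleftrightarrow> s = x"
proof -
  have "a \<notin> arc (a + 1) l s" if "s \<in> set_tree l"
    using arc_subset[OF that, of "a + 1"] by auto
  moreover have "a \<notin> arc (a + 2 * size l + 2) r s" if "s \<in> set_tree r"
    using arc_subset[OF that, of "a + 2 * size l + 2"] by auto
  ultimately show ?thesis using assms by auto
qed

text \<open>The tree can be read back from its arcs. The root is the label whose arc contains the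
  first point a, the other end of that arc gives the size of the left subtree, and the labels of the
  left subtree are those with arcs strictly inside.\<close>

lemma arc_inject:
  assumes "distinct (inorder t)" "distinct (inorder t')" "set_tree t = set_tree t'"
    and "\<And>s. s \<in> set_tree t \<Longrightarrow> arc a t s = arc a t' s"
  shows "t = t'"
  using assms
proof (induction t arbitrary: a t')
  case Leaf
  then show ?case by (cases t') auto
next
  case (Node l x r)
  then obtain l' x' r' where t': "t' = Node l' x' r'"
    by (cases t') auto
  let ?t = "Node l x r" and ?t' = "Node l' x' r'"
  note dist = Node.prems(1) Node.prems(2)[unfolded t']
  have set: "set_tree ?t = set_tree ?t'"
    using Node.prems(3) t' by simp
  have arc: "arc a ?t s = arc a ?t' s" if "s \<in> set_tree ?t" for s
    using Node.prems(4)[OF that] t' by simp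
  have x: "x' = x"
    using arc_root_iff[OF dist(1), of x a] arc_root_iff[OF dist(2), of x a] arc[of x] set by auto
  have "{a, a + 2 * size l + 1} = {a, a + 2 * size l' + 1}"
    using arc[of x] x by simp
  then have size: "size l' = size l"
    by (auto simp: doubleton_eq_iff)
  have l: "set_tree l = set_tree l'"
  proof -
    have "set_tree l = {s \<in> set_tree ?t. arc a ?t s \<subseteq> {a + 1..a + 2 * size l}}"
      using arc_subset_left_iff[OF dist(1), of _ a] by (auto simp del: arc.simps)
    also have "\<dots> = {s \<in> set_tree ?t'. arc a ?t' s \<subseteq> {a + 1..a + 2 * size l'}}"
      using set arc size by (auto simp del: arc.simps)
    also have "\<dots> = set_tree l'"
      using arc_subset_left_iff[OF dist(2), of _ a] by (auto simp del: arc.simps)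
    finally show ?thesis .
  qed
  have r: "set_tree r = set_tree r'"
  proof -
    have "set_tree r = set_tree ?t - insert x (set_tree l)"
      using dist(1) by auto
    also have "\<dots> = set_tree ?t' - insert x' (set_tree l')"
      unfolding set x l ..
    also have "\<dots> = set_tree r'"
      using dist(2) by auto
    finally show ?thesis .
  qed
  have "l = l'"
  proof (rule Node.IH(1)[of l' "a + 1"])
    fix s assume s: "s \<in> set_tree l"
    then have "s \<noteq> x" using dist(1) by auto
    then show "arc (a + 1) l s = arc (a + 1) l' s"
      using arc[of s] s l x by simp
  qed (use dist l in auto)
  moreover have "r = r'"
  proof (rule Node.IH(2)[of r' "a + 2 * size l + 2"])
    fix s assume s: "s \<in> set_tree r"
    then have "s \<noteq> x" "s \<notin> set_tree l" using dist(1) by auto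
    then show "arc (a + 2 * size l + 2) r s = arc (a + 2 * size l + 2) r' s"
      using arc[of s] s l x size by simp
  qed (use dist r in auto)
  ultimately show ?case using t' x by simp
qed

section \<open>Every noncrossing pairing is drawn by a tree\<close>

lemma card_Union_pairs:
  assumes "finite S" "disjoint_family_on f S" "\<And>s. s \<in> S \<Longrightarrow> card (f s) = 2"
  shows "card (\<Union>s\<in>S. f s) = 2 * card S"
proof -
  have "finite (f s)" if "s \<in> S" for s
    using assms(3)[OF that] by (intro card_ge_0_finite) simp
  then have "card (\<Union>s\<in>S. f s) = (\<Sum>s\<in>S. card (f s))"
    using assms(1,2) by (intro card_UN_disjoint) (auto simp: disjoint_family_on_def)
  then show ?thesis using assms(3) by simp
qed

text \<open>The pair containing the first point a becomes the root. No other pair crosses it, so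
  each lies either between a and its partner b or beyond b, and induction applies to the two
  groups.\<close>

lemma noncrossing_pairs_eq_arcs:
  assumes "finite S" "disjoint_family_on f S" "\<And>s. s \<in> S \<Longrightarrow> card (f s) = 2"
    and "(\<Union>s\<in>S. f s) = {a..<a + 2 * card S}"
    and "\<And>s y. s \<in> S \<Longrightarrow> y \<in> S \<Longrightarrow> \<not> crossing (f s) (f y)"
  shows "\<exists>t\<in>labelled_trees S. \<forall>s\<in>S. arc a t s = f s"
  using assms
proof (induction "card S" arbitrary: S a rule: less_induct)
  case less
  note fin = less.prems(1) and disj = less.prems(2) and card2 = less.prems(3)
    and Un = less.prems(4) and nc = less.prems(5)
  show ?case
  proof (cases "S = {}")
    case False
    have pair: "\<exists>i j. f s = {i, j} \<and> a \<le> i \<and> i < j \<and> j < a + 2 * card S" if "s \<in> S" for s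
    proof -
      obtain i j where ij: "f s = {i, j}" "i \<noteq> j"
        using card2[OF \<open>s \<in> S\<close>] by (auto simp: card_2_iff)
      have "f s \<subseteq> (\<Union>s\<in>S. f s)" using \<open>s \<in> S\<close> by blast
      then have sub: "{i, j} \<subseteq> {a..<a + 2 * card S}" unfolding Un ij(1) .
      show ?thesis
      proof (cases "i < j")
        case True
        then show ?thesis using ij sub by auto
      next
        case False
        then have "f s = {j, i} \<and> a \<le> j \<and> j < i \<and> i < a + 2 * card S"
          using ij sub by (auto simp: insert_commute)
        then show ?thesis by blast
      qed
    qed
    have "card S > 0" using False fin by auto
    then have "a \<in> (\<Union>s\<in>S. f s)" unfolding Un by simp
    then obtain x where x: "x \<in> S" "a \<in> f x" by blast
    then obtain b where b: "f x = {a, b}" "a < b" "b < a + 2 * card S"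
      using pair[OF x(1)] by force
    define S1 where "S1 = {s \<in> S. f s \<subseteq> {a<..<b}}"
    define S2 where "S2 = {s \<in> S. f s \<subseteq> {b<..<a + 2 * card S}}"
    have S12: "s \<in> S1 \<or> s \<in> S2" if s: "s \<in> S" "s \<noteq> x" for s
    proof -
      obtain i j where ij: "f s = {i, j}" "a \<le> i" "i < j" "j < a + 2 * card S"
        using pair[OF s(1)] by blast
      have "f s \<inter> f x = {}"
        using disj s x(1) by (auto simp: disjoint_family_on_def)
      moreover have "\<not> (a < i \<and> i < b \<and> b < j)"
        using nc[OF x(1) s(1)] ij b by (simp add: crossing_pair)
      ultimately show ?thesis
        using ij b s by (auto simp: S1_def S2_def)
    qed
    have ne: "f s \<noteq> {}" if "s \<in> S" for s using pair[OF that] by auto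
    have x12: "x \<notin> S1" "x \<notin> S2" by (auto simp: S1_def S2_def b)
    have dis12: "S1 \<inter> S2 = {}"
      using ne by (fastforce simp: S1_def S2_def)
    have S: "S = insert x (S1 \<union> S2)"
      using S12 x(1) by (auto simp: S1_def S2_def)
    have fin12: "finite S1" "finite S2"
      using fin by (auto simp: S1_def S2_def)
    have sub12: "S1 \<subseteq> S" "S2 \<subseteq> S" by (auto simp: S1_def S2_def)
    have cardS: "card S = Suc (card S1 + card S2)"
      unfolding S using x12 dis12 fin12 by (simp add: card_Un_disjoint)
    have disj12: "disjoint_family_on f S1" "disjoint_family_on f S2"
      using disj sub12 by (auto intro: disjoint_family_on_mono)
    have nc12: "\<And>s y. s \<in> S1 \<Longrightarrow> y \<in> S1 \<Longrightarrow> \<not> crossing (f s) (f y)"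
      "\<And>s y. s \<in> S2 \<Longrightarrow> y \<in> S2 \<Longrightarrow> \<not> crossing (f s) (f y)"
      using nc sub12 by blast+
    have Un1: "(\<Union>s\<in>S1. f s) = {a<..<b}"
    proof (intro equalityI subsetI)
      fix p assume p: "p \<in> {a<..<b}"
      then have "p \<in> (\<Union>s\<in>S. f s)" unfolding Un using b by auto
      then obtain s where s: "s \<in> S" "p \<in> f s" by blast
      moreover have "s \<noteq> x" using p s b by auto
      moreover have "s \<notin> S2" using p s by (auto simp: S2_def)
      ultimately show "p \<in> (\<Union>s\<in>S1. f s)" using S12 by blast
    qed (auto simp: S1_def)
    have Un2: "(\<Union>s\<in>S2. f s) = {b<..<a + 2 * card S}"
    proof (intro equalityI subsetI)
      fix p assume p: "p \<in> {b<..<a + 2 * card S}"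
      then have "p \<in> (\<Union>s\<in>S. f s)" unfolding Un using b by auto
      then obtain s where s: "s \<in> S" "p \<in> f s" by blast
      moreover have "s \<noteq> x" using p s b by auto
      moreover have "s \<notin> S1" using p s by (auto simp: S1_def)
      ultimately show "p \<in> (\<Union>s\<in>S2. f s)" using S12 by blast
    qed (auto simp: S2_def)
    \<comment> \<open>The pairs in \<open>S1\<close> fill the interval between a and b, so their
      number determines b.\<close>
    have "card (\<Union>s\<in>S1. f s) = 2 * card S1"
      using fin12 disj12 card2 sub12 by (intro card_Union_pairs) auto
    then have beq: "b = a + 1 + 2 * card S1"
      unfolding Un1 using b by simp
    have "\<exists>t\<in>labelled_trees S1. \<forall>s\<in>S1. arc (a + 1) t s = f s"
    proof (rule less.hyps)
      show "(\<Union>s\<in>S1. f s) = {a + 1..<a + 1 + 2 * card S1}"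
        unfolding Un1 beq by auto
    qed (use fin12 disj12 card2 sub12 nc12 cardS in auto)
    then obtain l where l: "l \<in> labelled_trees S1" "\<And>s. s \<in> S1 \<Longrightarrow> arc (a + 1) l s = f s"
      by blast
    have "\<exists>t\<in>labelled_trees S2. \<forall>s\<in>S2. arc (a + 2 * card S1 + 2) t s = f s"
    proof (rule less.hyps)
      show "(\<Union>s\<in>S2. f s) = {a + 2 * card S1 + 2..<a + 2 * card S1 + 2 + 2 * card S2}"
        unfolding Un2 beq cardS by auto
    qed (use fin12 disj12 card2 sub12 nc12 cardS in auto)
    then obtain r where r: "r \<in> labelled_trees S2"
        "\<And>s. s \<in> S2 \<Longrightarrow> arc (a + 2 * card S1 + 2) r s = f s"
      by blast
    have size: "size l = card S1"
      using l(1) size_eq_card_set_tree by (auto simp: labelled_trees_def)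
    have "Node l x r \<in> labelled_trees S"
      using l(1) r(1) S x12 dis12 by (auto simp: labelled_trees_def)
    moreover have "arc a (Node l x r) s = f s" if "s \<in> S" for s
    proof -
      have "set_tree l = S1" using l(1) by (simp add: labelled_trees_def)
      then show ?thesis
        using that S x12 dis12 l(2) r(2) size beq b by auto
    qed
    ultimately show ?thesis by blast
  qed simp
qed

section \<open>The bijection between labelled trees and ordered pair partitions\<close>

definition arc_list :: "nat \<Rightarrow> nat tree \<Rightarrow> nat set list" where
  "arc_list p t = map (arc 1 t) [0..<p]"

lemma set_arc_list: "set (arc_list p t) = arc 1 t ` {..<p}"
  by (auto simp: arc_list_def)

lemma inj_on_arc:
  assumes "distinct (inorder t)"
  shows "inj_on (arc a t) (set_tree t)"
proof (rule inj_onI)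
  fix s y assume "s \<in> set_tree t" "y \<in> set_tree t" "arc a t s = arc a t y"
  then show "s = y"
    using arc_disjoint[OF assms, of s y a] arc_nonempty[of s t a] by auto
qed

lemma arc_list_ONC_pair:
  assumes "t \<in> labelled_trees {..<p}"
  shows "arc_list p t \<in> ONC_pair (2 * p)"
proof -
  have t: "distinct (inorder t)" "set_tree t = {..<p}"
    using assms by (auto simp: labelled_trees_def)
  have size: "size t = p"
    using size_eq_card_set_tree[OF t(1)] t(2) by simp
  have "\<Union> (set (arc_list p t)) = {1..2 * p}"
    using Union_arc[OF t(1), of 1] t(2) size by (auto simp: set_arc_list)
  moreover have "disjoint (set (arc_list p t))"
    using arc_disjoint[OF t(1)] t(2) by (auto simp: set_arc_list disjoint_def)
  moreover have "{} \<notin> set (arc_list p t)"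
    using arc_nonempty[of _ t 1] t(2) by (auto simp: set_arc_list)
  moreover have "distinct (arc_list p t)"
    using inj_on_arc[OF t(1), of 1] t(2) by (simp add: arc_list_def distinct_map atLeast0LessThan)
  moreover have "noncrossing (set (arc_list p t))"
    using arc_not_crossing[OF t(1)] t(2) by (auto simp: set_arc_list noncrossing_iff)
  moreover have "\<forall>P\<in>set (arc_list p t). card P = 2"
    using card_arc[of _ t 1] t(2) by (auto simp: set_arc_list)
  ultimately show ?thesis
    by (simp add: ONC_pair_def ordered_set_partition_def partition_on_def)
qed

lemma bij_betw_arc_list: "bij_betw (arc_list p) (labelled_trees {..<p}) (ONC_pair (2 * p))"
  unfolding bij_betw_def
proof (intro conjI equalityI subsetI)
  show "inj_on (arc_list p) (labelled_trees {..<p})"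
  proof (rule inj_onI)
    fix t t' assume "t \<in> labelled_trees {..<p}" "t' \<in> labelled_trees {..<p}"
      and "arc_list p t = arc_list p t'"
    then show "t = t'"
      by (intro arc_inject[of t t' 1]) (auto simp: labelled_trees_def arc_list_def)
  qed
next
  fix \<pi> assume \<pi>: "\<pi> \<in> ONC_pair (2 * p)"
  then have dist: "distinct \<pi>" and Un: "\<Union> (set \<pi>) = {1..2 * p}" and disj: "disjoint (set \<pi>)"
    and nc: "noncrossing (set \<pi>)" and card2: "\<And>P. P \<in> set \<pi> \<Longrightarrow> card P = 2"
    by (auto simp: ONC_pair_def ordered_set_partition_def partition_on_def)
  let ?S = "{..<length \<pi>}"
  have set: "set \<pi> = (!) \<pi> ` ?S"
    by (auto simp: in_set_conv_nth)
  have fam: "disjoint_family_on ((!) \<pi>) ?S"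
    unfolding disjoint_family_on_def
  proof (intro ballI impI)
    fix i j assume "i \<in> ?S" "j \<in> ?S" "i \<noteq> j"
    then show "\<pi> ! i \<inter> \<pi> ! j = {}"
      using disj dist by (intro disjointD[OF disj]) (auto simp: nth_eq_iff_index_eq)
  qed
  have UnS: "(\<Union>s\<in>?S. \<pi> ! s) = {1..2 * p}"
    using Un unfolding set by simp
  \<comment> \<open>Counting points gives the number of blocks, so the labels are exactly
    \<open>{..<p}\<close>.\<close>
  have "card (\<Union>s\<in>?S. \<pi> ! s) = 2 * card ?S"
    by (rule card_Union_pairs) (use fam card2 in auto)
  then have p: "length \<pi> = p"
    unfolding UnS by simp
  have "\<exists>t\<in>labelled_trees ?S. \<forall>s\<in>?S. arc 1 t s = \<pi> ! s"
  proof (rule noncrossing_pairs_eq_arcs)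
    show "(\<Union>s\<in>?S. \<pi> ! s) = {1..<1 + 2 * card ?S}"
      unfolding UnS using p by auto
  next
    fix s y assume "s \<in> ?S" "y \<in> ?S"
    then show "\<not> crossing (\<pi> ! s) (\<pi> ! y)"
    proof (cases "\<pi> ! s = \<pi> ! y")
      case True
      \<comment> \<open>\<open>noncrossing\<close> only concerns different blocks; a block of two
        points cannot cross itself, as a crossing takes four distinct points.\<close>
      have "card (\<pi> ! s) = 2" using card2 \<open>s \<in> ?S\<close> by simp
      then show ?thesis
        unfolding True[symmetric] by (auto simp: crossing_def card_2_iff)
    next
      case False
      then show ?thesis
        using nc \<open>s \<in> ?S\<close> \<open>y \<in> ?S\<close> by (simp add: noncrossing_iff)
    qed
  qed (use fam card2 in auto)
  then obtain t where t: "t \<in> labelled_trees {..<p}" "\<forall>s<p. arc 1 t s = \<pi> ! s"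
    using p by auto
  then have "arc_list p t = \<pi>"
    using p by (intro nth_equalityI) (auto simp: arc_list_def)
  with t(1) show "\<pi> \<in> arc_list p ` labelled_trees {..<p}" by blast
qed (use arc_list_ONC_pair in auto)

section \<open>Nearest covers and block counts\<close>

lemma precedes_arc_list:
  assumes "t \<in> labelled_trees {..<p}" "s < p" "y < p"
  shows "precedes (arc_list p t) (arc 1 t s) (arc 1 t y) \<longleftrightarrow> s < y"
proof -
  have "inj_on (arc 1 t) {..<p}"
    using assms(1) inj_on_arc[of t 1] by (auto simp: labelled_trees_def)
  then have inj: "arc 1 t i = arc 1 t j \<longleftrightarrow> i = j" if "i < p" "j < p" for i j
    using that by (auto simp: inj_on_eq_iff)
  have nth: "arc_list p t ! i = arc 1 t i" if "i < p" for i
    using that by (simp add: arc_list_def)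
  have len: "length (arc_list p t) = p"
    by (simp add: arc_list_def)
  show ?thesis
    unfolding precedes_def len using nth inj assms(2,3) by (metis order.strict_trans)
qed

text \<open>Between arcs, covering is the ancestor relation. Since every other ancestor of s lies
  above the parent x, nothing fits between x and s, and any other candidate has x between itself and
  s.\<close>

lemma nearest_cover_arc_list:
  assumes t: "t \<in> labelled_trees {..<p}" and s: "s < p" and parent: "parent t s = Some x"
  shows "nearest_cover (arc_list p t) (arc 1 t s) = arc 1 t x"
proof -
  have dist: "distinct (inorder t)" and set: "set_tree t = {..<p}"
    using t by (auto simp: labelled_trees_def)
  note covers = covers_arc_iff[OF dist, unfolded set lessThan_iff]
  have x: "ancestor t x s" "\<And>y. ancestor t y s \<Longrightarrow> y = x \<or> ancestor t y x"
    using parent_SomeD[OF dist parent] by auto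
  have "x < p" using ancestor_mem[OF x(1)] set by simp
  \<comment> \<open>Two arcs cannot cover each other, as each would reach strictly beyond the
    other.\<close>
  have asym: "\<not> (ancestor t y z \<and> ancestor t z y)" if yz: "y < p" "z < p" for y z
  proof
    assume "ancestor t y z \<and> ancestor t z y"
    then have "covers (arc 1 t y) (arc 1 t z)" "covers (arc 1 t z) (arc 1 t y)"
      using covers yz by auto
    moreover have mem: "y \<in> set_tree t" "z \<in> set_tree t"
      using yz set by auto
    moreover obtain i j where "arc 1 t y = {i, j}" "1 \<le> i" "i < j" "j < 1 + 2 * size t"
      by (rule arc_eq_pair[OF mem(1)])
    moreover obtain k l where "arc 1 t z = {k, l}" "1 \<le> k" "k < l" "l < 1 + 2 * size t"
      by (rule arc_eq_pair[OF mem(2)])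
    ultimately show False by (simp add: covers_pair)
  qed
  show ?thesis
    unfolding nearest_cover_def
  proof (rule the_equality)
    show "arc 1 t x \<in> set (arc_list p t) \<and> covers (arc 1 t x) (arc 1 t s) \<and>
        \<not> (\<exists>P'\<in>set (arc_list p t). covers P' (arc 1 t s) \<and> covers (arc 1 t x) P')"
    proof (intro conjI notI)
      show "arc 1 t x \<in> set (arc_list p t)"
        using \<open>x < p\<close> by (simp add: set_arc_list)
      show "covers (arc 1 t x) (arc 1 t s)"
        using covers[OF s \<open>x < p\<close>] x(1) by blast
    next
      assume "\<exists>P'\<in>set (arc_list p t). covers P' (arc 1 t s) \<and> covers (arc 1 t x) P'"
      then obtain z where z: "z < p" "covers (arc 1 t z) (arc 1 t s)" "covers (arc 1 t x) (arc 1 t z)"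
        unfolding set_arc_list by blast
      then have "ancestor t z s" "ancestor t x z"
        using covers[OF s z(1)] covers[OF z(1) \<open>x < p\<close>] by blast+
      then show False
        using x(2)[of z] asym[of x z] \<open>x < p\<close> z(1) by blast
    qed
  next
    fix C assume C: "C \<in> set (arc_list p t) \<and> covers C (arc 1 t s) \<and>
        \<not> (\<exists>P'\<in>set (arc_list p t). covers P' (arc 1 t s) \<and> covers C P')"
    then obtain y where y: "y < p" "C = arc 1 t y"
      unfolding set_arc_list by auto
    with C have "ancestor t y s" using covers[OF s y(1)] by simp
    then have "y = x \<or> ancestor t y x" by (rule x(2))
    moreover have "\<not> ancestor t y x"
    proof
      assume "ancestor t y x"
      then have "covers C (arc 1 t x)"
        unfolding y(2) using covers[OF \<open>x < p\<close> y(1)] by simp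
      moreover have "covers (arc 1 t x) (arc 1 t s)" "arc 1 t x \<in> set (arc_list p t)"
        using covers[OF s \<open>x < p\<close>] x(1) \<open>x < p\<close> by (simp_all add: set_arc_list)
      ultimately show False using C by blast
    qed
    ultimately show "C = arc 1 t x" using y by simp
  qed
qed

lemma inner_blocks_arc_list:
  assumes "t \<in> labelled_trees {..<p}"
  shows "inner_blocks (arc_list p t) = arc 1 t ` {s \<in> {..<p}. parent t s \<noteq> None}"
proof -
  have dist: "distinct (inorder t)" and set: "set_tree t = {..<p}"
    using assms by (auto simp: labelled_trees_def)
  note covers = covers_arc_iff[OF dist, unfolded set lessThan_iff]
  have "(\<exists>P\<in>arc 1 t ` {..<p}. covers P (arc 1 t s)) \<longleftrightarrow> parent t s \<noteq> None" if "s < p" for s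
  proof -
    have "(\<exists>P\<in>arc 1 t ` {..<p}. covers P (arc 1 t s)) \<longleftrightarrow> (\<exists>y<p. covers (arc 1 t y) (arc 1 t s))"
      by auto
    also have "\<dots> \<longleftrightarrow> (\<exists>y<p. ancestor t y s)"
      using covers[OF that] by auto
    also have "\<dots> \<longleftrightarrow> (\<exists>y. ancestor t y s)"
      using ancestor_mem[of t _ s] set by auto
    finally show ?thesis by (simp add: parent_None_iff)
  qed
  moreover have "{P \<in> f ` A. Q P} = f ` {s \<in> A. Q (f s)}" for f :: "nat \<Rightarrow> nat set" and A Q
    by blast
  ultimately show ?thesis
    unfolding inner_blocks_def set_arc_list by (simp only: lessThan_iff cong: conj_cong)
qed

lemma prod_three_valued:
  fixes u v w :: "'b::comm_monoid_mult"
  assumes "finite S"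
  shows "(\<Prod>s\<in>S. if P s then u else if Q s then v else w) =
    u ^ card {s \<in> S. P s} * v ^ card {s \<in> S. \<not> P s \<and> Q s} * w ^ card {s \<in> S. \<not> P s \<and> \<not> Q s}"
proof -
  have "(\<Prod>s\<in>S. if P s then u else if Q s then v else w) =
      u ^ card (S \<inter> {s. P s}) * (v ^ card (S \<inter> - {s. P s} \<inter> {s. Q s}) *
      w ^ card (S \<inter> - {s. P s} \<inter> - {s. Q s}))"
    using assms by (simp add: prod.If_cases)
  also have "S \<inter> {s. P s} = {s \<in> S. P s}" by auto
  also have "S \<inter> - {s. P s} \<inter> {s. Q s} = {s \<in> S. \<not> P s \<and> Q s}" by auto
  also have "S \<inter> - {s. P s} \<inter> - {s. Q s} = {s \<in> S. \<not> P s \<and> \<not> Q s}" by auto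
  finally show ?thesis by (simp add: mult.assoc)
qed

text \<open>The product of edge weights is sorted by the kind of block: no parent for outer blocks,
  a parent with smaller label for \<open>blocks_B\<close>, one with larger label for
  \<open>blocks_C\<close>.\<close>

lemma forest_weight_eq_block_counts:
  assumes t: "t \<in> labelled_trees {..<p}"
  shows "forest_weight v w (\<lambda>_. u) t = u ^ card (outer_blocks (arc_list p t)) *
    v ^ card (blocks_B (arc_list p t)) * w ^ card (blocks_C (arc_list p t))"
proof -
  let ?\<pi> = "arc_list p t"
  have dist: "distinct (inorder t)" and set: "set_tree t = {..<p}"
    using t by (auto simp: labelled_trees_def)
  have inj: "inj_on (arc 1 t) {..<p}"
    using inj_on_arc[OF dist, of 1] set by simp
  \<comment> \<open>A parent never equals its child, so the negation of \<open>x < s\<close> means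
    \<open>s < x\<close>, as \<open>blocks_C\<close> requires.\<close>
  have parent: "x < p" "x \<noteq> s" if "parent t s = Some x" for s x
  proof -
    have anc: "ancestor t x s" using parent_SomeD[OF dist that] by blast
    then show "x < p" using ancestor_mem set by blast
    have s: "s \<in> set_tree t" using ancestor_mem anc by blast
    then obtain i j where "arc 1 t s = {i, j}" "i < j" by (rule arc_eq_pair)
    then have "\<not> ancestor t s s"
      using covers_arc_iff[OF dist s s, of 1] by (simp add: covers_pair)
    with anc show "x \<noteq> s" by blast
  qed
  let ?O = "{s \<in> {..<p}. parent t s = None}"
  let ?B = "{s \<in> {..<p}. parent t s \<noteq> None \<and> the (parent t s) < s}"
  let ?C = "{s \<in> {..<p}. parent t s \<noteq> None \<and> \<not> the (parent t s) < s}"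
  have "outer_blocks ?\<pi> = arc 1 t ` {..<p} - arc 1 t ` {s \<in> {..<p}. parent t s \<noteq> None}"
    by (simp add: outer_blocks_def set_arc_list inner_blocks_arc_list[OF t])
  also have "\<dots> = arc 1 t ` ({..<p} - {s \<in> {..<p}. parent t s \<noteq> None})"
    by (rule inj_on_image_set_diff[OF inj, symmetric]) auto
  also have "{..<p} - {s \<in> {..<p}. parent t s \<noteq> None} = ?O" by auto
  finally have O: "outer_blocks ?\<pi> = arc 1 t ` ?O" .
  have prec: "precedes ?\<pi> (nearest_cover ?\<pi> (arc 1 t s)) (arc 1 t s) \<longleftrightarrow> the (parent t s) < s"
    "precedes ?\<pi> (arc 1 t s) (nearest_cover ?\<pi> (arc 1 t s)) \<longleftrightarrow> \<not> the (parent t s) < s"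
    if "s < p" "parent t s \<noteq> None" for s
  proof -
    obtain x where x: "parent t s = Some x" using \<open>parent t s \<noteq> None\<close> by auto
    note parent = parent[OF x]
    show "precedes ?\<pi> (nearest_cover ?\<pi> (arc 1 t s)) (arc 1 t s) \<longleftrightarrow> the (parent t s) < s"
      "precedes ?\<pi> (arc 1 t s) (nearest_cover ?\<pi> (arc 1 t s)) \<longleftrightarrow> \<not> the (parent t s) < s"
      unfolding nearest_cover_arc_list[OF t that(1) x] x
        precedes_arc_list[OF t parent(1) that(1)] precedes_arc_list[OF t that(1) parent(1)]
      using parent by auto
  qed
  have B: "blocks_B ?\<pi> = arc 1 t ` ?B"
    unfolding blocks_B_def inner_blocks_arc_list[OF t] using prec(1) by auto
  have C: "blocks_C ?\<pi> = arc 1 t ` ?C"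
    unfolding blocks_C_def inner_blocks_arc_list[OF t] using prec(2) by auto
  have card: "card (arc 1 t ` A) = card A" if "A \<subseteq> {..<p}" for A
    using inj that by (meson card_image inj_on_subset)
  have "forest_weight v w (\<lambda>_. u) t =
      (\<Prod>s\<in>{..<p}. if parent t s = None then u else if the (parent t s) < s then v else w)"
    unfolding forest_weight_eq_prod[OF dist] set
    by (intro prod.cong) (auto simp: edge_weight_def split: option.splits)
  also have "\<dots> = u ^ card ?O * v ^ card ?B * w ^ card ?C"
    by (rule prod_three_valued) simp
  also have "\<dots> = u ^ card (outer_blocks ?\<pi>) * v ^ card (blocks_B ?\<pi>) * w ^ card (blocks_C ?\<pi>)"
    unfolding O B C by (subst (1 2 3) card) auto
  finally show ?thesis .
qed

section \<open>The moments and their generating series\<close>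

lemma lambda_moment_even:
  assumes "v + w \<noteq> 0"
  shows "lambda_moment u v w (2 * p) = fps_nth (forest_series (v + w) u) p"
proof -
  have "(\<Sum>\<pi>\<in>ONC_pair (2 * p). u ^ card (outer_blocks \<pi>) * v ^ card (blocks_B \<pi>) *
      w ^ card (blocks_C \<pi>)) = forest_sum v w (\<lambda>_. u) {..<p}"
    unfolding forest_sum_def
    by (subst sum.reindex_bij_betw[OF bij_betw_arc_list, symmetric])
       (simp add: forest_weight_eq_block_counts)
  also have "\<dots> = fact p * fps_nth (forest_series (v + w) u) p"
    by (simp add: forest_sum_fps[OF assms])
  \<comment> \<open>The factor \<open>1 / fact p\<close> in the moments is the normalization of
    exponential generating functions, so the moments are plain coefficients.\<close>
  finally have "fps_nth (forest_series (v + w) u) p = (\<Sum>\<pi>\<in>ONC_pair (2 * p).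
      1 / fact p * u ^ card (outer_blocks \<pi>) * v ^ card (blocks_B \<pi>) * w ^ card (blocks_C \<pi>))"
    by (simp add: mult.assoc flip: sum_distrib_left sum_divide_distrib)
  moreover have "fps_nth (forest_series (v + w) u) 0 = 1"
    by (simp add: forest_series_def)
  ultimately show ?thesis
    by (cases "p = 0") (simp_all add: lambda_moment_def)
qed

text \<open>Odd moments vanish, so the substitution of \<open>fps_X ^ 2\<close> for t gives the full
  moment series.\<close>

lemma lambda_moment_series:
  assumes "v + w \<noteq> 0"
  shows "Abs_fps (lambda_moment u v w) = forest_series (v + w) u oo fps_X ^ 2"
proof (rule fps_ext)
  fix n
  show "fps_nth (Abs_fps (lambda_moment u v w)) n = fps_nth (forest_series (v + w) u oo fps_X ^ 2) n"
  proof (cases "even n")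
    case True
    then obtain p where "n = 2 * p" by blast
    then show ?thesis by (simp add: lambda_moment_even[OF assms] fps_nth_compose_X_power)
  next
    case False
    then have "n \<noteq> 0" by (cases n) auto
    with False show ?thesis by (simp add: lambda_moment_def fps_nth_compose_X_power)
  qed
qed

section \<open>Distributions and their reciprocal Cauchy transforms\<close>

lemma linear_lambda_dist: "Vector_Spaces.linear smult (*) (lambda_dist u v w)"
proof -
  \<comment> \<open>Any bound beyond the degree gives the same sum, so polynomials of different
    degrees can share one range of summation.\<close>
  have bound: "lambda_dist u v w p = (\<Sum>n\<le>N. coeff p n * lambda_moment u v w n)"
    if "degree p \<le> N" for p N
    unfolding lambda_dist_def
    by (rule sum.mono_neutral_left) (use that in \<open>auto simp: coeff_eq_0\<close>)
  have "vector_space (smult :: complex \<Rightarrow> complex poly \<Rightarrow> complex poly)"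
    by unfold_locales (auto simp: smult_add_right smult_add_left)
  moreover have "vector_space ((*) :: complex \<Rightarrow> complex \<Rightarrow> complex)"
    by unfold_locales (auto simp: algebra_simps)
  moreover have "lambda_dist u v w (p + q) = lambda_dist u v w p + lambda_dist u v w q" for p q
  proof -
    let ?N = "max (degree p) (degree q)"
    have "degree (p + q) \<le> ?N" by (rule degree_add_le_max)
    then show ?thesis
      by (simp add: bound[of _ ?N] distrib_right sum.distrib)
  qed
  moreover have "lambda_dist u v w (smult c p) = c * lambda_dist u v w p" for c p
    by (subst bound[of _ "degree p"]) (auto simp: lambda_dist_def sum_distrib_left mult.assoc degree_smult_le)
  ultimately show ?thesis
    by (intro Vector_Spaces.linear.intro module_hom.intro module_hom_axioms.intro)
       (auto simp: vector_space_def module_def)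
qed

lemma lambda_dist_monom: "lambda_dist u v w (monom 1 n) = lambda_moment u v w n"
proof -
  have "lambda_dist u v w (monom 1 n) = (\<Sum>k\<le>n. if k = n then lambda_moment u v w k else 0)"
    unfolding lambda_dist_def by (rule sum.cong) (auto simp: degree_monom_eq)
  then show ?thesis by simp
qed

lemma distribution_lambda_dist: "distribution (lambda_dist u v w)"
  using linear_lambda_dist lambda_dist_monom[of u v w 0]
  by (simp add: distribution_def lambda_moment_def)

lemma distribution_eqI:
  assumes "distribution \<phi>" "distribution \<psi>" "\<And>n. \<phi> (monom 1 n) = \<psi> (monom 1 n)"
  shows "\<phi> = \<psi>"
proof
  fix p :: "complex poly"
  interpret \<phi>: Vector_Spaces.linear smult "(*)" \<phi> using assms(1) by (simp add: distribution_def)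
  interpret \<psi>: Vector_Spaces.linear smult "(*)" \<psi> using assms(2) by (simp add: distribution_def)
  have p: "p = (\<Sum>i\<le>degree p. smult (coeff p i) (monom 1 i))"
    by (simp add: smult_monom poly_as_sum_of_monoms)
  show "\<phi> p = \<psi> p"
    by (subst (1 2) p) (simp add: \<phi>.sum \<psi>.sum \<phi>.scale \<psi>.scale assms(3))
qed

text \<open>Inversion is injective on Laurent series, so F determines G and with it all
  moments.\<close>

lemma reciprocal_cauchy_transform_inject:
  assumes "distribution \<phi>" "distribution \<psi>"
    and "reciprocal_cauchy_transform \<phi> = reciprocal_cauchy_transform \<psi>"
  shows "\<phi> = \<psi>"
proof -
  have "inverse (cauchy_transform \<phi>) = inverse (cauchy_transform \<psi>)"
    using assms(3) by (simp add: reciprocal_cauchy_transform_def divide_inverse)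
  then have "Abs_fps (\<lambda>n. \<phi> (monom 1 n)) = Abs_fps (\<lambda>n. \<psi> (monom 1 n))"
    by (simp add: cauchy_transform_def)
  then have "\<phi> (monom 1 n) = \<psi> (monom 1 n)" for n
    by (simp add: fps_eq_iff)
  then show ?thesis by (rule distribution_eqI[OF assms(1,2)])
qed

text \<open>G is \<open>M / z\<close>, where M is \<open>1 / (1 - u T)\<close> at
  \<open>t = 1 / z^2\<close>. Hence F is \<open>z (1 - u T)\<close>, and the closed form of T makes
  this affine in the square root.\<close>

lemma reciprocal_cauchy_transform_lambda_dist:
  assumes "v + w \<noteq> 0"
  shows "reciprocal_cauchy_transform (lambda_dist u v w) =
    fls_const (1 - u / (v + w)) * zvar
    + fls_const (u / (v + w)) * zvar * sqrt_one_minus_over_z2 (2 * (v + w))"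
proof -
  define c where "c = v + w"
  define M where "M = forest_series c u oo fps_X ^ 2"
  define R where "R = fps_binomial (1/2) oo (fps_const (- (2 * c)) * fps_X ^ 2)"
  have R: "sqrt_series (2 * c) oo fps_X ^ 2 = R"
    unfolding sqrt_series_def R_def
    by (subst fps_compose_assoc[symmetric]) (simp_all add: fps_compose_mult_distrib)
  have "(1 - fps_const u * tree_series c) * forest_series c u oo fps_X ^ 2 = 1 oo fps_X ^ 2"
    by (simp only: forest_series_times)
  then have "(1 - fps_const u * (fps_const (1 / c) * (1 - R))) * M = 1"
    by (simp add: M_def tree_series_def fps_compose_mult_distrib fps_compose_sub_distrib R)
  moreover have "1 - fps_const u * (fps_const (1 / c) * (1 - R)) =
      fps_const (1 - u / c) + fps_const (u / c) * R"
    by (simp add: algebra_simps flip: fps_const_sub)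
  ultimately have "fps_to_fls ((fps_const (1 - u / c) + fps_const (u / c) * R) * M) = 1"
    by simp
  then have inv: "(fls_const (1 - u / c) + fls_const (u / c) * fps_to_fls R) * fps_to_fls M = 1"
    by (simp add: fls_times_fps_to_fls fps_to_fls_plus)
  then have A: "(fls_const (1 - u / c) + fls_const (u / c) * fps_to_fls R) = 1 / fps_to_fls M"
    by (metis nonzero_eq_divide_eq mult_zero_right zero_neq_one)
  have rct: "reciprocal_cauchy_transform (lambda_dist u v w) = zvar * (1 / fps_to_fls M)"
    using lambda_moment_series[OF assms, of u]
    by (simp add: reciprocal_cauchy_transform_def cauchy_transform_def lambda_dist_monom
        M_def c_def fls_times_fps_to_fls divide_inverse fls_inverse_X mult.commute)
  have sqrt: "sqrt_one_minus_over_z2 (2 * c) = fps_to_fls R"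
    by (simp only: sqrt_one_minus_over_z2_def R_def)
  show ?thesis
    unfolding c_def[symmetric] rct sqrt A[symmetric] by (simp only: distrib_left mult_ac)
qed

theorem theorem6p6:
  fixes u v w :: complex
  assumes "v + w \<noteq> 0"
  shows "distribution (lambda_dist u v w) \<and> distribution (mu_dist v w) \<and> distribution (nu_dist v w) \<and>
    (\<forall>l m n. distribution l \<longrightarrow> distribution m \<longrightarrow> distribution n \<longrightarrow>
      (l = lambda_dist u v w \<and> m = mu_dist v w \<and> n = nu_dist v w \<longleftrightarrow>
        reciprocal_cauchy_transform l =
          fls_const (1 - u / (v + w)) * zvar
          + fls_const (u / (v + w)) * zvar * sqrt_one_minus_over_z2 (2 * (v + w)) \<and>
        reciprocal_cauchy_transform m =
          fls_const (1 - v / (v + w)) * zvar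
          + fls_const (v / (v + w)) * zvar * sqrt_one_minus_over_z2 (2 * (v + w)) \<and>
        reciprocal_cauchy_transform n =
          fls_const (1 - w / (v + w)) * zvar
          + fls_const (w / (v + w)) * zvar * sqrt_one_minus_over_z2 (2 * (v + w))))"
  \<comment> \<open>As mu and nu are the cases \<open>u = v\<close> and \<open>u = w\<close>, the
    three formulas fold back into reciprocal transforms of the given distributions; injectivity then
    yields the equivalence.\<close>
  unfolding mu_dist_def nu_dist_def reciprocal_cauchy_transform_lambda_dist[OF assms, symmetric]
  using distribution_lambda_dist reciprocal_cauchy_transform_inject by metis

end
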